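(* There is an analytic equivalence relation $E$ (on a Polish space) such that $E$ is Borel graphable, has the Borel pair-coding property and the weak Borel witness coding property (and hence also the weak Borel coding property and the weak Borel pair-coding property), but does not have the Borel coding property.
   Context: Let $E$ be an analytic equivalence relation on a Polish space $X$; "computes" means Turing reducibility, elements of $X$ are identified with fixed codes in $2^{\mathbb{N}}$, $\le_h$ is hyperarithmetic reducibility and $\oplus$ the Turing join. An unfolding of $E$ is a Borel $C\subseteq X^2\times2^{\mathbb{N}}$ with $(x,x,z)\in C$ for all $z$, $(x,y,z)\in C\iff(y,x,z)\in C$, and $xEy\iff\exists z\,(x,y,z)\in C$; such $z$ is a witness to $xEy$. $E$ is Borel graphable if it is the connectedness relation of a Borel graph on $X$. Borel coding property: there is a Borel $f\colon X\to2^{\mathbb{N}}$ such that for all $x\in X$, $a\in2^{\mathbb{N}}$ there is $y\,E\,x$ with $f(y)$ computing $a$. Borel pair-coding property: there is a Borel $f\colon X\times X\to2^{\mathbb{N}}$ such that for all $x,a$ there is $y\,E\,x$ with $f(x,y)$ computing $a$. Weak versions replace "computable from $f(\cdot)$" by "hyperarithmetic relative to the argument(s) together with a fixed oracle $c$": weak Borel witness coding property: there are an unfolding $C$ and $c\in2^{\mathbb{N}}$ such that for all $x,a$ there is $y\,E\,x$ with $a\le_h y\oplus c$ and some witness $z$ to $xEy$ with $z\le_h y\oplus c$; weak Borel coding: there is $c$ such that for all $x,a$ there is $y\,E\,x$ with $a\le_h y\oplus c$; weak Borel pair-coding: there is $c$ such that for all $x,a$ there is $y\,E\,x$ with $a\le_h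 x\oplus y\oplus c$. *)

theory Defs
  imports "HOL-Analysis.Analysis" "HOL-Library.Nat_Bijection"
begin

subsection \<open>Turing reducibility on Cantor space\<close>

text \<open>
  Points of Cantor space have type \<^typ>\<open>nat \<Rightarrow> bool\<close>, with the product topology.
  Oracle programs denote the unary partial recursive functions relative to an oracle;
  further arguments are passed through the Cantor pairing function \<^const>\<open>prod_encode\<close>.
\<close>

datatype oprog =
    Zero | Succ | Fst | Snd | Query
  | Pairing oprog oprog
  | Comp oprog oprog
  | Prec oprog oprog
  | Mu oprog

inductive computes_to :: "(nat \<Rightarrow> bool) \<Rightarrow> oprog \<Rightarrow> nat \<Rightarrow> nat \<Rightarrow> bool"
  for X :: "nat \<Rightarrow> bool"
where
  "computes_to X Zero n 0"
| "computes_to X Succ n (Suc n)"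
| "computes_to X Fst n (fst (prod_decode n))"
| "computes_to X Snd n (snd (prod_decode n))"
| "computes_to X Query n (of_bool (X n))"
| "computes_to X p n a \<Longrightarrow> computes_to X q n b
    \<Longrightarrow> computes_to X (Pairing p q) n (prod_encode (a, b))"
| "computes_to X q n m \<Longrightarrow> computes_to X p m r \<Longrightarrow> computes_to X (Comp p q) n r"
| "computes_to X p a r \<Longrightarrow> computes_to X (Prec p q) (prod_encode (a, 0)) r"
| "computes_to X (Prec p q) (prod_encode (a, k)) s
    \<Longrightarrow> computes_to X q (prod_encode (a, prod_encode (k, s))) r
    \<Longrightarrow> computes_to X (Prec p q) (prod_encode (a, Suc k)) r"
| "computes_to X p (prod_encode (a, k)) 0
    \<Longrightarrow> (\<forall>i<k. \<exists>v. computes_to X p (prod_encode (a, i)) (Suc v))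
    \<Longrightarrow> computes_to X (Mu p) a k"

definition turing_le :: "(nat \<Rightarrow> bool) \<Rightarrow> (nat \<Rightarrow> bool) \<Rightarrow> bool"  (infix \<open>\<le>\<^sub>T\<close> 50)
  where "a \<le>\<^sub>T b \<longleftrightarrow> (\<exists>p. \<forall>n. computes_to b p n (of_bool (a n)))"

definition turing_join :: "(nat \<Rightarrow> bool) \<Rightarrow> (nat \<Rightarrow> bool) \<Rightarrow> nat \<Rightarrow> bool"  (infixr \<open>\<oplus>\<^sub>T\<close> 65)
  where "a \<oplus>\<^sub>T b = (\<lambda>n. if even n then a (n div 2) else b (n div 2))"


subsection \<open>The Turing jump and hyperarithmetic reducibility\<close>

primrec goedel_number :: "oprog \<Rightarrow> nat" where
  "goedel_number Zero = prod_encode (0, 0)"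
| "goedel_number Succ = prod_encode (1, 0)"
| "goedel_number Fst = prod_encode (2, 0)"
| "goedel_number Snd = prod_encode (3, 0)"
| "goedel_number Query = prod_encode (4, 0)"
| "goedel_number (Pairing p q) = prod_encode (5, prod_encode (goedel_number p, goedel_number q))"
| "goedel_number (Comp p q) = prod_encode (6, prod_encode (goedel_number p, goedel_number q))"
| "goedel_number (Prec p q) = prod_encode (7, prod_encode (goedel_number p, goedel_number q))"
| "goedel_number (Mu p) = prod_encode (8, goedel_number p)"

lemma goedel_number_inject: "goedel_number p = goedel_number q \<longleftrightarrow> p = q"
proof (induction p arbitrary: q)
qed (case_tac q; simp)+

definition turing_jump :: "(nat \<Rightarrow> bool) \<Rightarrow> nat \<Rightarrow> bool"
  where "turing_jump X = (\<lambda>e. \<exists>p v. e = goedel_number p \<and> computes_to X p e v)"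

text \<open>
  Iteration of the jump of \<open>y\<close> along a well-order \<open>R\<close> of a set of natural numbers:
  the stage at \<open>n\<close> is the jump of \<open>y\<close> joined with all stages strictly below \<open>n\<close>. The least
  stage is the jump of \<open>y\<close>, and the stage at a limit is the jump of the join of the earlier ones.
\<close>

definition jump_hierarchy :: "(nat \<Rightarrow> bool) \<Rightarrow> nat rel \<Rightarrow> (nat \<Rightarrow> nat \<Rightarrow> bool) \<Rightarrow> bool"
  where "jump_hierarchy y R H \<longleftrightarrow>
    (\<forall>n\<in>Field R. H n = turing_jump (y \<oplus>\<^sub>T
      (\<lambda>k. case prod_decode k of (m, i) \<Rightarrow> (m, n) \<in> R \<and> m \<noteq> n \<and> H m i)))"

text \<open>
  \<open>a\<close> is hyperarithmetic in \<open>y\<close> if it is computable from a transfinite iterate of the jump of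
  \<open>y\<close> along a well-order computable in \<open>y\<close>, i.e. from some \<open>y\<^bsup>(\<alpha>)\<^esup>\<close> with \<open>\<alpha> < \<omega>\<^sub>1\<^bsup>y\<^esup>\<close>.
\<close>

definition hyp_le :: "(nat \<Rightarrow> bool) \<Rightarrow> (nat \<Rightarrow> bool) \<Rightarrow> bool"  (infix \<open>\<le>\<^sub>h\<close> 50)
  where "a \<le>\<^sub>h y \<longleftrightarrow>
    (\<exists>R H. Well_order R \<and> (\<lambda>k. prod_decode k \<in> R) \<le>\<^sub>T y \<and> jump_hierarchy y R H \<and>
      (\<exists>n\<in>Field R. a \<le>\<^sub>T H n))"


subsection \<open>Analytic equivalence relations on Polish spaces\<close>

definition Polish_space :: "'a topology \<Rightarrow> bool"
  where "Polish_space X \<longleftrightarrow> completely_metrizable_space X \<and> second_countable X"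

definition borel_of :: "'a topology \<Rightarrow> 'a measure"
  where "borel_of X = sigma (topspace X) {U. openin X U}"

abbreviation cantor_space :: "(nat \<Rightarrow> bool) topology"
  where "cantor_space \<equiv> euclidean"

text \<open>
  Every Polish space has at most continuum many points, so taking the auxiliary space \<open>Y\<close> on a
  subset of \<^typ>\<open>nat \<Rightarrow> bool\<close>, with an arbitrary topology, is no restriction.
\<close>

definition analytic_in :: "'a topology \<Rightarrow> 'a set \<Rightarrow> bool"
  where "analytic_in X A \<longleftrightarrow>
    (\<exists>(Y :: (nat \<Rightarrow> bool) topology) B. Polish_space Y \<and>
      B \<in> sets (borel_of (prod_topology X Y)) \<and> A = fst ` B)"

definition analytic_equiv :: "'a topology \<Rightarrow> 'a rel \<Rightarrow> bool"
  where "analytic_equiv X E \<longleftrightarrow> equiv (topspace X) E \<and> analytic_in (prod_topology X X) E"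

definition borel_graph :: "'a topology \<Rightarrow> 'a rel \<Rightarrow> bool"
  where "borel_graph X G \<longleftrightarrow> G \<in> sets (borel_of (prod_topology X X)) \<and> sym G \<and> irrefl G"

definition borel_graphable :: "'a topology \<Rightarrow> 'a rel \<Rightarrow> bool"
  where "borel_graphable X E \<longleftrightarrow>
    (\<exists>G. borel_graph X G \<and> E = {(x, y). x \<in> topspace X \<and> y \<in> topspace X \<and> (x, y) \<in> G\<^sup>*})"

definition unfolding_of :: "'a topology \<Rightarrow> 'a rel \<Rightarrow> ('a \<times> 'a \<times> (nat \<Rightarrow> bool)) set \<Rightarrow> bool"
  where "unfolding_of X E C \<longleftrightarrow>
    C \<in> sets (borel_of (prod_topology X (prod_topology X cantor_space))) \<and>
    (\<forall>x\<in>topspace X. \<forall>z. (x, x, z) \<in> C) \<and>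
    (\<forall>x\<in>topspace X. \<forall>y\<in>topspace X. \<forall>z. (x, y, z) \<in> C \<longleftrightarrow> (y, x, z) \<in> C) \<and>
    (\<forall>x\<in>topspace X. \<forall>y\<in>topspace X. (x, y) \<in> E \<longleftrightarrow> (\<exists>z. (x, y, z) \<in> C))"


subsection \<open>Coding properties\<close>

definition borel_coding :: "'a topology \<Rightarrow> 'a rel \<Rightarrow> bool"
  where "borel_coding X E \<longleftrightarrow>
    (\<exists>f \<in> borel_of X \<rightarrow>\<^sub>M borel_of cantor_space.
      \<forall>x\<in>topspace X. \<forall>a. \<exists>y. (y, x) \<in> E \<and> a \<le>\<^sub>T f y)"

definition borel_pair_coding :: "'a topology \<Rightarrow> 'a rel \<Rightarrow> bool"
  where "borel_pair_coding X E \<longleftrightarrow>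
    (\<exists>f \<in> borel_of (prod_topology X X) \<rightarrow>\<^sub>M borel_of cantor_space.
      \<forall>x\<in>topspace X. \<forall>a. \<exists>y. (y, x) \<in> E \<and> a \<le>\<^sub>T f (x, y))"

text \<open>
  The identification of points of \<open>X\<close> with codes in Cantor space is a Borel injection. The weak
  coding properties do not depend on its choice, since two such injections are hyperarithmetically
  reducible to each other relative to a parameter, which the oracle \<open>c\<close> absorbs.
\<close>

definition coding_map :: "'a topology \<Rightarrow> ('a \<Rightarrow> nat \<Rightarrow> bool) \<Rightarrow> bool"
  where "coding_map X code \<longleftrightarrow>
    code \<in> borel_of X \<rightarrow>\<^sub>M borel_of cantor_space \<and> inj_on code (topspace X)"

definition weak_borel_witness_coding ::
    "'a topology \<Rightarrow> ('a \<Rightarrow> nat \<Rightarrow> bool) \<Rightarrow> 'a rel \<Rightarrow> bool"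
  where "weak_borel_witness_coding X code E \<longleftrightarrow>
    (\<exists>C c. unfolding_of X E C \<and>
      (\<forall>x\<in>topspace X. \<forall>a. \<exists>y. (y, x) \<in> E \<and> a \<le>\<^sub>h code y \<oplus>\<^sub>T c \<and>
        (\<exists>z. (x, y, z) \<in> C \<and> z \<le>\<^sub>h code y \<oplus>\<^sub>T c)))"

definition weak_borel_coding :: "'a topology \<Rightarrow> ('a \<Rightarrow> nat \<Rightarrow> bool) \<Rightarrow> 'a rel \<Rightarrow> bool"
  where "weak_borel_coding X code E \<longleftrightarrow>
    (\<exists>c. \<forall>x\<in>topspace X. \<forall>a. \<exists>y. (y, x) \<in> E \<and> a \<le>\<^sub>h code y \<oplus>\<^sub>T c)"

definition weak_borel_pair_coding :: "'a topology \<Rightarrow> ('a \<Rightarrow> nat \<Rightarrow> bool) \<Rightarrow> 'a rel \<Rightarrow> bool"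
  where "weak_borel_pair_coding X code E \<longleftrightarrow>
    (\<exists>c. \<forall>x\<in>topspace X. \<forall>a. \<exists>y. (y, x) \<in> E \<and> a \<le>\<^sub>h code x \<oplus>\<^sub>T code y \<oplus>\<^sub>T c)"

end

theory Submission
  imports Defs "HOL-Library.Sublist"
begin

text \<open>
  Points are pairs \<open>(w, u)\<close>, where \<open>w\<close> codes a linear order together with a recipe for building Borel
  sets along it. If the order is a well-order, Cohen forcing decides membership of \<open>(w, u)\<close> in these
  sets by a transfinite recursion of length \<open>w\<close>. The good points are those with \<open>w\<close> well-ordered and
  \<open>u\<close> sufficiently generic for this forcing relation \<open>H\<close>. All bad points form one class, and two good
  points are equivalent if they share \<open>w\<close>.

  A real can be coded into a generic \<open>u\<close> and decoded by means of \<open>H\<close>, which is hyperarithmetic in \<open>w\<close>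
  but not uniformly Borel in it. Two generic sequences can be made to differ exactly at positions that
  code a given real, which gives Borel pair-coding; coding \<open>H\<close> itself in this way makes the
  edges of a graph on the good points Borel. If a Borel \<open>f\<close> is given, choose \<open>w\<close> to contain the recipe
  for all sets of points \<open>x\<close> such that the \<open>p\<close>-th program with oracle \<open>f x\<close> outputs \<open>1\<close> at \<open>n\<close>:
  a real that diagonalises against \<open>H\<close> is then computed by no \<open>f (w, u)\<close> with \<open>u\<close> generic.
\<close>

subsection \<open>Topology of Cantor space\<close>

text \<open>Goodness is coanalytic, so a Borel unfolding cannot assert it. Merging all bad points
  into one class is what makes \<open>class_rel\<close> analytic: badness itself has witnesses, and
  a witness for good points need not vouch for the well-order. The bad class does no harm to coding,
  since it contains all points whose \<open>w\<close> is constantly False and whose other half is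
  arbitrary.

  The negative part works because all members of a good class share \<open>w\<close>, hence
  \<open>H\<close>, while \<open>f\<close> is fixed before \<open>w\<close> is chosen. The diagonal
  real depends on \<open>w\<close> alone and escapes the whole class at once. Each program is
  refuted at an input that names an initial segment of \<open>u\<close>, so different
  \<open>u\<close> may use different inputs.

  No program computing the forcing relation is ever written down. The parameter \<open>c\<close> of
  the weak properties absorbs the uniform part of every computation as a table, consulted by a
  single search program.\<close>

instance bool :: second_countable_topology
proof
  have "(open :: bool set \<Rightarrow> bool) = generate_topology UNIV"
    by (auto simp: fun_eq_iff open_discrete intro: generate_topology.Basis)
  thus "\<exists>B::bool set set. countable B \<and> open = generate_topology B"
    by (intro exI[of _ UNIV]) (simp add: uncountable_infinite countable_finite)
qed

lemma second_countable_euclidean: "second_countable (euclidean :: 'a::second_countable_topology topology)"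
proof -
  obtain B :: "'a set set" where B: "countable B" "topological_basis B"
    using ex_countable_basis by blast
  have "\<forall>V\<in>B. openin euclidean V"
    using B(2) topological_basis_open by auto
  moreover have "\<forall>U x. openin euclidean U \<and> x \<in> U \<longrightarrow> (\<exists>V\<in>B. x \<in> V \<and> V \<subseteq> U)"
    using B(2) by (metis open_openin topological_basisE)
  ultimately show ?thesis
    unfolding second_countable_def using B(1) by blast
qed

lemma Polish_space_cantor: "Polish_space cantor_space"
proof -
  have "discrete_topology UNIV = (euclidean :: bool topology)"
    by (simp add: topology_eq openin_discrete_topology open_discrete flip: open_openin)
  hence "completely_metrizable_space (euclidean :: bool topology)"
    by (metis completely_metrizable_space_discrete_topology)
  hence "completely_metrizable_space (product_topology (\<lambda>_::nat. euclidean :: bool topology) UNIV)"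
    by (auto simp: completely_metrizable_space_product_topology)
  thus ?thesis
    by (simp add: Polish_space_def second_countable_euclidean euclidean_product_topology)
qed

lemma sets_borel_of_euclidean: "sets (borel_of euclidean) = sets borel"
  by (simp add: borel_of_def borel_def sets_measure_of flip: open_openin)

lemma measurable_borel_of_euclidean:
  "borel_of euclidean \<rightarrow>\<^sub>M borel_of euclidean = borel \<rightarrow>\<^sub>M borel"
  by (rule measurable_cong_sets) (simp_all add: sets_borel_of_euclidean)

lemma eventually_nhds_bit: "\<forall>\<^sub>F y in nhds x. y i = x i" for x :: "nat \<Rightarrow> bool"
proof -
  have "continuous_on UNIV (\<lambda>y::nat \<Rightarrow> bool. y i)"
    by (intro continuous_on_product_coordinates)
  hence "open ((\<lambda>y::nat \<Rightarrow> bool. y i) -` {x i})"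
    by (intro open_vimage) (simp_all add: open_discrete)
  thus ?thesis
    unfolding eventually_nhds by (intro exI conjI) (assumption, auto)
qed

lemma eventually_nhds_bits: "\<forall>\<^sub>F y in nhds x. \<forall>i<k. y i = x i" for x :: "nat \<Rightarrow> bool"
proof (induction k)
  case (Suc k)
  show ?case
    using eventually_conj[OF Suc eventually_nhds_bit[of k x]]
    by eventually_elim (auto simp: less_Suc_eq)
qed auto

lemma open_cantor_iff:
  "open V \<longleftrightarrow> (\<forall>x\<in>V. \<exists>k. \<forall>y. (\<forall>i<k. y i = x i) \<longrightarrow> y \<in> V)" for V :: "(nat \<Rightarrow> bool) set"
proof
  assume V: "open V"
  show "\<forall>x\<in>V. \<exists>k. \<forall>y. (\<forall>i<k. y i = x i) \<longrightarrow> y \<in> V"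
  proof
    fix x assume "x \<in> V"
    from product_topology_open_contains_basis[OF V[unfolded open_fun_def] this]
    obtain X where X: "x \<in> (\<Pi>\<^sub>E i\<in>UNIV. X i)" "finite {i. X i \<noteq> topspace euclidean}"
        "(\<Pi>\<^sub>E i\<in>UNIV. X i) \<subseteq> V"
      by blast
    define k where "k = Suc (Max (insert 0 {i. X i \<noteq> topspace euclidean}))"
    have "y \<in> V" if "\<forall>i<k. y i = x i" for y
    proof -
      have "y i \<in> X i" for i
      proof (cases "i < k")
        case True
        thus ?thesis using that X(1) by (simp add: PiE_iff)
      next
        case False
        hence "i \<notin> {i. X i \<noteq> topspace euclidean}"
          using Max_ge[of "insert 0 {i. X i \<noteq> topspace euclidean}" i] X(2) unfolding k_def
          by (meson finite_insert insertI2 le_imp_less_Suc)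
        thus ?thesis by simp
      qed
      thus ?thesis using X(3) by (auto simp: PiE_iff)
    qed
    thus "\<exists>k. \<forall>y. (\<forall>i<k. y i = x i) \<longrightarrow> y \<in> V" by blast
  qed
next
  assume *: "\<forall>x\<in>V. \<exists>k. \<forall>y. (\<forall>i<k. y i = x i) \<longrightarrow> y \<in> V"
  show "open V"
  proof (rule topological_space_class.openI)
    fix x assume "x \<in> V"
    then obtain k where k: "\<forall>y. (\<forall>i<k. y i = x i) \<longrightarrow> y \<in> V" using * by blast
    have "\<forall>\<^sub>F y in nhds x. y \<in> V"
      using eventually_nhds_bits[of k x] by eventually_elim (use k in auto)
    thus "\<exists>T. open T \<and> x \<in> T \<and> T \<subseteq> V"
      unfolding eventually_nhds by auto
  qed
qed

subsection \<open>Oracle programs\<close>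

lemmas computes_intros = computes_to.intros

inductive_cases computes_ZeroE: "computes_to X Zero n v"
inductive_cases computes_SuccE: "computes_to X Succ n v"
inductive_cases computes_FstE: "computes_to X Fst n v"
inductive_cases computes_SndE: "computes_to X Snd n v"
inductive_cases computes_QueryE: "computes_to X Query n v"
inductive_cases computes_PairingE: "computes_to X (Pairing p q) n v"
inductive_cases computes_CompE: "computes_to X (Comp p q) n v"
inductive_cases computes_PrecE: "computes_to X (Prec p q) n v"
inductive_cases computes_MuE: "computes_to X (Mu p) n v"

lemma computes_to_deterministic:
  "computes_to X p n v \<Longrightarrow> computes_to X p n v' \<Longrightarrow> v = v'"
proof (induction arbitrary: v' rule: computes_to.induct)
  case (6 p n a q b)
  from 6(5) show ?case by (rule computes_PairingE) (use 6(3,4) in blast)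
next
  case (7 q n m p r)
  from 7(5) show ?case by (rule computes_CompE) (use 7(3,4) in blast)
next
  case (8 p a r q)
  from 8(3) show ?case
    by (rule computes_PrecE) (use 8(2) in \<open>simp_all add: prod_encode_eq\<close>)
next
  case (9 p q a k s r)
  from 9(5) show ?case
  proof (rule computes_PrecE)
    fix a' k' s'
    assume *: "prod_encode (a, Suc k) = prod_encode (a', Suc k')"
      "computes_to X (Prec p q) (prod_encode (a', k')) s'"
      "computes_to X q (prod_encode (a', prod_encode (k', s'))) v'"
    hence "a' = a" "k' = k" by (simp_all add: prod_encode_eq)
    with * 9(3)[of s'] 9(4)[of v'] show "r = v'" by simp
  qed (simp add: prod_encode_eq)
next
  case (10 p a k)
  from 10(4) show ?case
  proof (rule computes_MuE)
    assume *: "computes_to X p (prod_encode (a, v')) 0"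
      "\<forall>i<v'. \<exists>v. computes_to X p (prod_encode (a, i)) (Suc v)"
    show "k = v'"
    proof (rule linorder_cases[of k v'])
      assume "k < v'"
      thus ?thesis using *(2) 10(2) by blast
    next
      assume "v' < k"
      thus ?thesis using 10(3) *(1) by blast
    qed simp
  qed
qed (blast elim: computes_ZeroE computes_SuccE computes_FstE computes_SndE computes_QueryE)+

text \<open>A halting computation queries only finitely many bits of its oracle; for
  \<open>Mu\<close> only the arguments up to the result count. This makes the sets used in the
  diagonalisation Borel.\<close>

lemma eventually_computes_to:
  "computes_to X p n v \<Longrightarrow> \<forall>\<^sub>F Y in nhds X. computes_to Y p n v"
proof (induction rule: computes_to.induct)
  case (5 n)
  show ?case
    using eventually_nhds_bit[of n X] 
  proof eventually_elim
    case (elim Y)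
    thus ?case using computes_intros(5)[of Y n] by simp
  qed
next
  case (6 p n a q b)
  from 6(3,4) show ?case by eventually_elim (rule computes_intros)
next
  case (7 q n m p r)
  from 7(3,4) show ?case by eventually_elim (rule computes_intros)
next
  case (8 p a r q)
  from 8(2) show ?case by eventually_elim (rule computes_intros)
next
  case (9 p q a k s r)
  from 9(3,4) show ?case by eventually_elim (rule computes_intros)
next
  case (10 p a k)
  have "\<forall>\<^sub>F Y in nhds X. \<exists>v. computes_to Y p (prod_encode (a, i)) (Suc v)" if i: "i < k" for i
  proof -
    obtain v where "\<forall>\<^sub>F Y in nhds X. computes_to Y p (prod_encode (a, i)) (Suc v)"
      using 10(3) i by blast
    thus ?thesis by eventually_elim blast
  qed
  hence "\<forall>\<^sub>F Y in nhds X. \<forall>i\<in>{..<k}. \<exists>v. computes_to Y p (prod_encode (a, i)) (Suc v)"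
    by (intro eventually_ball_finite) auto
  with 10(2) show ?case
    by eventually_elim (rule computes_intros, auto)
qed (auto intro: computes_intros always_eventually)

lemma open_computes_to: "open {X. computes_to X p n v}"
proof (rule topological_space_class.openI)
  fix X assume "X \<in> {X. computes_to X p n v}"
  with eventually_computes_to[of X p n v] show "\<exists>T. open T \<and> X \<in> T \<and> T \<subseteq> {X. computes_to X p n v}"
    by (auto simp: eventually_nhds)
qed

definition idp :: oprog where "idp = Pairing Fst Snd"

lemma computes_idp: "computes_to X idp n n"
  using computes_intros(6)[OF computes_intros(3)[of X n] computes_intros(4)[of X n]]
  by (simp add: idp_def)

lemma computes_Fst: "computes_to X Fst (prod_encode (a, b)) a"
  using computes_intros(3)[of X "prod_encode (a, b)"] by simp

lemma computes_Snd: "computes_to X Snd (prod_encode (a, b)) b"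
  using computes_intros(4)[of X "prod_encode (a, b)"] by simp

primrec addp :: "nat \<Rightarrow> oprog" where
  "addp 0 = idp"
| "addp (Suc a) = Comp Succ (addp a)"

lemma computes_addp: "computes_to X (addp a) n (n + a)"
  by (induction a) (auto intro: computes_idp computes_intros(7)[OF _ computes_intros(2)])

definition cstp :: "nat \<Rightarrow> oprog" where "cstp a = Comp (addp a) Zero"

lemma computes_cstp: "computes_to X (cstp a) n a"
  using computes_intros(7)[OF computes_intros(1) computes_addp[of X a 0]] by (simp add: cstp_def)

definition recp :: "oprog \<Rightarrow> oprog \<Rightarrow> oprog" where
  "recp p q = Comp (Prec p q) (Pairing Zero idp)"

lemma computes_recp:
  assumes "computes_to X p 0 (f 0)"
    and "\<And>k. computes_to X q (prod_encode (0, prod_encode (k, f k))) (f (Suc k))"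
  shows "computes_to X (recp p q) n (f n)"
proof -
  have "computes_to X (Prec p q) (prod_encode (0, n)) (f n)"
    by (induction n) (auto intro: computes_intros(8,9) assms)
  thus ?thesis
    unfolding recp_def
    by (rule computes_intros(7)[OF computes_intros(6)[OF computes_intros(1) computes_idp]])
qed

definition linp :: "nat \<Rightarrow> nat \<Rightarrow> oprog" where
  "linp a b = recp (cstp b) (Comp (addp a) (Comp Snd Snd))"

lemma computes_linp: "computes_to X (linp a b) n (a * n + b)"
  unfolding linp_def
proof (rule computes_recp)
  fix k
  show "computes_to X (Comp (addp a) (Comp Snd Snd)) (prod_encode (0, prod_encode (k, a * k + b)))
    (a * Suc k + b)"
    using computes_intros(7)[OF computes_intros(7)[OF computes_Snd computes_Snd]
        computes_addp[of X a "a * k + b"]]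
    by (simp add: algebra_simps)
qed (simp add: computes_cstp)

lemma turing_le_refl: "a \<le>\<^sub>T a"
  unfolding turing_le_def by (intro exI[of _ Query] allI computes_intros)

lemma turing_le_query:
  assumes "\<And>n. computes_to b p n (g n)" and "\<And>n. a n = b (g n)"
  shows "a \<le>\<^sub>T b"
  unfolding turing_le_def
proof (intro exI allI)
  fix n
  show "computes_to b (Comp Query p) n (of_bool (a n))"
    using computes_intros(7)[OF assms(1)[of n] computes_intros(5)] assms(2) by simp
qed

subsection \<open>The jump of an oracle that contains a table\<close>

text \<open>Infinitely many distinct programs for the identity: composing with them gives one search
  program infinitely many indices, one for each row of a table.\<close>

primrec pad_idp :: "nat \<Rightarrow> oprog" where
  "pad_idp 0 = idp"
| "pad_idp (Suc j) = Comp idp (pad_idp j)"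

lemma computes_pad_idp: "computes_to X (pad_idp j) n n"
  by (induction j) (auto intro: computes_idp computes_intros(7)[OF _ computes_idp])

lemma pad_idp_inj: "pad_idp i = pad_idp j \<longleftrightarrow> i = j"
proof (induction i arbitrary: j)
  case 0
  show ?case by (cases j) (auto simp: idp_def)
next
  case (Suc i)
  thus ?case by (cases j) (auto simp: idp_def)
qed

text \<open>The number alone does not fix the length, as \<open>prod_encode (0, 0) = 0\<close>;
  tables therefore store \<open>k\<close> next to it.\<close>

primrec code_prefix :: "(nat \<Rightarrow> bool) \<Rightarrow> nat \<Rightarrow> nat" where
  "code_prefix X 0 = 0"
| "code_prefix X (Suc k) = prod_encode (code_prefix X k, of_bool (X k))"

lemma code_prefix_eq_iff: "code_prefix X k = code_prefix Y k \<longleftrightarrow> (\<forall>i<k. X i = Y i)"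
  by (induction k) (auto simp: less_Suc_eq)

definition prefixp :: oprog where
  "prefixp = recp Zero (Pairing (Comp Snd Snd) (Comp Query (Comp Fst Snd)))"

lemma computes_prefixp: "computes_to X prefixp k (code_prefix X k)"
  unfolding prefixp_def
proof (rule computes_recp)
  fix k
  show "computes_to X (Pairing (Comp Snd Snd) (Comp Query (Comp Fst Snd)))
      (prod_encode (0, prod_encode (k, code_prefix X k))) (code_prefix X (Suc k))"
    unfolding code_prefix.simps
    by (rule computes_intros(6)[OF computes_intros(7)[OF computes_Snd computes_Snd]
        computes_intros(7)[OF computes_intros(7)[OF computes_Snd computes_Fst] computes_intros(5)]])
qed (simp add: computes_intros(1))

text \<open>The program consults a table inside its own oracle, at positions
  \<open>a * l + b\<close>, for growing initial segments of that same oracle. \<open>Mu\<close>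
  looks for the value 0, so an entry False means a hit.\<close>

definition searchp :: "nat \<Rightarrow> nat \<Rightarrow> oprog" where
  "searchp a b = Mu (Comp Query (Comp (linp a b) (Pairing Fst (Pairing Snd (Comp prefixp Snd)))))"

lemma computes_searchp_iff:
  "(\<exists>v. computes_to X (searchp a b) n v) \<longleftrightarrow>
    (\<exists>k. \<not> X (a * prod_encode (n, prod_encode (k, code_prefix X k)) + b))"
proof -
  let ?body = "Comp Query (Comp (linp a b) (Pairing Fst (Pairing Snd (Comp prefixp Snd))))"
  let ?B = "\<lambda>k. X (a * prod_encode (n, prod_encode (k, code_prefix X k)) + b)"
  have body: "computes_to X ?body (prod_encode (n, k)) (of_bool (?B k))" for k
    by (intro computes_intros(7)[OF computes_intros(7)[OF computes_intros(6)[OF computes_Fst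
        computes_intros(6)[OF computes_Snd computes_intros(7)[OF computes_Snd computes_prefixp]]]
        computes_linp] computes_intros(5)])
  show ?thesis
  proof
    assume "\<exists>v. computes_to X (searchp a b) n v"
    then obtain v where "computes_to X (searchp a b) n v" ..
    hence "computes_to X ?body (prod_encode (n, v)) 0"
      unfolding searchp_def by (rule computes_MuE)
    from computes_to_deterministic[OF this body] show "\<exists>k. \<not> ?B k" by auto
  next
    assume ex: "\<exists>k. \<not> ?B k"
    define k where "k = (LEAST k. \<not> ?B k)"
    have "\<not> ?B k" unfolding k_def using ex by (rule LeastI_ex)
    moreover have "?B i" if "i < k" for i
      using not_less_Least[of i "\<lambda>k. \<not> ?B k"] that unfolding k_def by blast
    ultimately have "computes_to X ?body (prod_encode (n, k)) 0"
        "\<forall>i<k. computes_to X ?body (prod_encode (n, i)) (Suc 0)"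
      using body[of k] body by (simp, metis of_bool_eq(2) One_nat_def)
    hence "computes_to X (searchp a b) n k"
      unfolding searchp_def by (blast intro: computes_intros(10))
    thus "\<exists>v. computes_to X (searchp a b) n v" ..
  qed
qed

text \<open>The jump runs a program on its own index. The search thus receives its index as input
  and looks up the row named by it, so no parameter has to be substituted into programs.\<close>

definition table_index :: "nat \<Rightarrow> nat \<Rightarrow> nat \<Rightarrow> nat" where
  "table_index a b j = goedel_number (Comp (searchp a b) (pad_idp j))"

lemma table_index_inj: "table_index a b i = table_index a b j \<longleftrightarrow> i = j"
  by (simp only: table_index_def goedel_number_inject pad_idp_inj oprog.inject simp_thms)

lemma turing_jump_table_index:
  "turing_jump X (table_index a b j) \<longleftrightarrow> (\<exists>k. \<not> X (a * prod_encode (table_index a b j,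
     prod_encode (k, code_prefix X k)) + b))"
proof -
  let ?e = "table_index a b j"
  have "turing_jump X ?e \<longleftrightarrow> (\<exists>v. computes_to X (Comp (searchp a b) (pad_idp j)) ?e v)"
    unfolding turing_jump_def table_index_def goedel_number_inject by blast
  also have "\<dots> \<longleftrightarrow> (\<exists>v. computes_to X (searchp a b) ?e v)"
  proof
    assume "\<exists>v. computes_to X (Comp (searchp a b) (pad_idp j)) ?e v"
    then obtain v m where "computes_to X (pad_idp j) ?e m" "computes_to X (searchp a b) m v"
      by (auto elim: computes_CompE)
    thus "\<exists>v. computes_to X (searchp a b) ?e v"
      using computes_to_deterministic[OF _ computes_pad_idp] by blast
  qed (blast intro: computes_intros(7)[OF computes_pad_idp])
  finally show ?thesis by (simp add: computes_searchp_iff)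
qed

lemma computes_table_index: "\<exists>p. \<forall>X j. computes_to X p j (table_index a b j)"
proof -
  define p where "p = Pairing (cstp 6) (Pairing (cstp (goedel_number (searchp a b)))
    (recp (cstp (goedel_number idp)) (Pairing (cstp 6) (Pairing (cstp (goedel_number idp)) (Comp Snd Snd)))))"
  have "computes_to X p j (table_index a b j)" for X j
  proof -
    have "computes_to X (recp (cstp (goedel_number idp)) (Pairing (cstp 6)
        (Pairing (cstp (goedel_number idp)) (Comp Snd Snd)))) j (goedel_number (pad_idp j))"
    proof (rule computes_recp)
      fix k
      show "computes_to X (Pairing (cstp 6) (Pairing (cstp (goedel_number idp)) (Comp Snd Snd)))
         (prod_encode (0, prod_encode (k, goedel_number (pad_idp k)))) (goedel_number (pad_idp (Suc k)))"
        unfolding pad_idp.simps goedel_number.simps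
        by (intro computes_intros(6) computes_cstp computes_intros(7)[OF computes_Snd computes_Snd])
    qed (simp add: computes_cstp)
    thus ?thesis
      unfolding table_index_def goedel_number.simps p_def
      by (intro computes_intros(6) computes_cstp)
  qed
  thus ?thesis by blast
qed

text \<open>
  The oracle may hold an arbitrary table, so at the indices \<open>table_index a b j\<close> the jump can be made
  to agree with any prescribed sequence of open sets.
\<close>

lemma jump_table:
  fixes V :: "nat \<Rightarrow> (nat \<Rightarrow> bool) set"
  assumes "\<And>j. open (V j)"
  obtains c where "\<And>X j. (\<And>k. X (a * k + b) = c k) \<Longrightarrow> turing_jump X (table_index a b j) \<longleftrightarrow> X \<in> V j"
proof
  \<comment> \<open>An entry is False iff the open set of the row contains the cylinder of the
    stored segment. The table is defined from \<open>V\<close> alone, so there is no circularity in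
    \<open>X\<close> containing the table.\<close>
  define c where "c = (\<lambda>l. case prod_decode l of (e, l') \<Rightarrow> case prod_decode l' of (k, s) \<Rightarrow>
    \<not> (\<exists>j. e = table_index a b j \<and> {Y. code_prefix Y k = s} \<subseteq> V j))"
  fix X j assume X: "\<And>k. X (a * k + b) = c k"
  have "turing_jump X (table_index a b j) \<longleftrightarrow> (\<exists>k. {Y. code_prefix Y k = code_prefix X k} \<subseteq> V j)"
    by (simp add: turing_jump_table_index X c_def table_index_inj)
  also have "\<dots> \<longleftrightarrow> X \<in> V j"
  proof
    assume "X \<in> V j"
    then obtain k where "\<forall>Y. (\<forall>i<k. Y i = X i) \<longrightarrow> Y \<in> V j"
      using assms[of j] unfolding open_cantor_iff by blast
    thus "\<exists>k. {Y. code_prefix Y k = code_prefix X k} \<subseteq> V j"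
      by (intro exI[of _ k]) (auto simp: code_prefix_eq_iff)
  qed auto
  finally show "turing_jump X (table_index a b j) \<longleftrightarrow> X \<in> V j" .
qed

lemma turing_le_table:
  assumes "\<And>i. a' i = J (table_index a b (prod_encode (t, i)))"
  shows "a' \<le>\<^sub>T J"
proof -
  obtain p where p: "\<And>X j. computes_to X p j (table_index a b j)"
    using computes_table_index by blast
  show ?thesis
  proof (rule turing_le_query)
    show "computes_to J (Comp p (Pairing (cstp t) idp)) n (table_index a b (prod_encode (t, n)))" for n
      by (rule computes_intros(7)[OF computes_intros(6)[OF computes_cstp computes_idp] p])
  qed (rule assms)
qed

lemma join_even: "(a \<oplus>\<^sub>T b) (2 * k) = a k" and join_odd: "(a \<oplus>\<^sub>T b) (2 * k + 1) = b k"
  by (simp_all add: turing_join_def)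

section \<open>Jump hierarchies along well-founded relations\<close>

definition hier_below :: "nat rel \<Rightarrow> (nat \<Rightarrow> nat \<Rightarrow> bool) \<Rightarrow> nat \<Rightarrow> nat \<Rightarrow> bool" where
  "hier_below R J n = (\<lambda>k. case prod_decode k of (m, i) \<Rightarrow> (m, n) \<in> R \<and> m \<noteq> n \<and> J m i)"

lemma hier_below_simp: "hier_below R J n (prod_encode (m, i)) \<longleftrightarrow> (m, n) \<in> R \<and> m \<noteq> n \<and> J m i"
  by (simp add: hier_below_def)

lemma jump_hierarchy_iff:
  "jump_hierarchy y R J \<longleftrightarrow> (\<forall>n\<in>Field R. J n = turing_jump (y \<oplus>\<^sub>T hier_below R J n))"
  by (simp add: jump_hierarchy_def hier_below_def)

lemma ex_jump_hierarchy:
  assumes "wf (R - Id)"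
  shows "\<exists>J. jump_hierarchy y R J"
proof -
  define F where "F = (\<lambda>J n. turing_jump (y \<oplus>\<^sub>T hier_below R J n))"
  have "adm_wf (R - Id) F"
    unfolding adm_wf_def
  proof (intro allI impI)
    fix f g :: "nat \<Rightarrow> nat \<Rightarrow> bool" and n
    assume "\<forall>z. (z, n) \<in> R - Id \<longrightarrow> f z = g z"
    hence "hier_below R f n = hier_below R g n"
      by (auto simp: hier_below_def fun_eq_iff split: prod.splits)
    thus "F f n = F g n" by (simp add: F_def)
  qed
  from fun_cong[OF wfrec_fixpoint[OF assms this]]
  have "wfrec (R - Id) F n = F (wfrec (R - Id) F) n" for n .
  thus ?thesis
    unfolding jump_hierarchy_iff by (intro exI[of _ "wfrec (R - Id) F"]) (auto simp: F_def)
qed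

subsection \<open>Generic sequences\<close>

text \<open>
  A sequence counts as generic if every finite modification of it meets all the given sets. This is
  stable under changing the sequence at sparse positions, which leaves room for coding.
\<close>

definition generic_on :: "nat set \<Rightarrow> (nat \<Rightarrow> bool list \<Rightarrow> bool) \<Rightarrow> (nat \<Rightarrow> bool) \<Rightarrow> bool" where
  "generic_on A D u \<longleftrightarrow> (\<forall>k r. \<exists>t. prefix r t \<and> D k t \<and>
     (\<forall>i\<in>A. length r \<le> i \<longrightarrow> i < length t \<longrightarrow> t ! i = u i))"

abbreviation generic :: "(nat \<Rightarrow> bool list \<Rightarrow> bool) \<Rightarrow> (nat \<Rightarrow> bool) \<Rightarrow> bool" where
  "generic \<equiv> generic_on UNIV"

definition dense_family :: "(nat \<Rightarrow> bool list \<Rightarrow> bool) \<Rightarrow> bool" where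
  "dense_family D \<longleftrightarrow> (\<forall>k r. \<exists>t. prefix r t \<and> D k t)"

lemma generic_on_mono: "generic_on B D u \<Longrightarrow> A \<subseteq> B \<Longrightarrow> generic_on A D u"
  unfolding generic_on_def by (meson subsetD)

text \<open>Finite-extension argument: by \<open>congI\<close> and \<open>congP\<close> only the
  first \<open>n\<close> values at a stage count, so what a stage achieves survives in the limit of
  the approximations.\<close>

lemma stagewise_construction:
  fixes I :: "nat \<Rightarrow> (nat \<Rightarrow> 'a) \<Rightarrow> bool" and P :: "nat \<Rightarrow> nat \<Rightarrow> (nat \<Rightarrow> 'a) \<Rightarrow> bool"
  assumes base: "I 0 init"
    and step: "\<And>s n z. I n z \<Longrightarrow> \<exists>n' z'. n < n' \<and> (\<forall>i<n. z' i = z i) \<and> I n' z' \<and> P s n' z'"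
    and congI: "\<And>n z z'. I n z \<Longrightarrow> (\<And>i. i < n \<Longrightarrow> z i = z' i) \<Longrightarrow> I n z'"
    and congP: "\<And>s n z z'. P s n z \<Longrightarrow> (\<And>i. i < n \<Longrightarrow> z i = z' i) \<Longrightarrow> P s n z'"
  shows "\<exists>z. \<forall>s. \<exists>n>s. I n z \<and> P s n z"
proof -
  have "\<exists>f. I (fst (f 0)) (snd (f 0)) \<and> (\<forall>s. I (fst (f (Suc s))) (snd (f (Suc s))) \<and>
      fst (f s) < fst (f (Suc s)) \<and> (\<forall>i<fst (f s). snd (f (Suc s)) i = snd (f s) i) \<and>
      P s (fst (f (Suc s))) (snd (f (Suc s))))"
  proof -
    have "\<exists>f. \<forall>s. I (fst (f s)) (snd (f s)) \<and>
        (fst (f s) < fst (f (Suc s)) \<and> (\<forall>i<fst (f s). snd (f (Suc s)) i = snd (f s) i) \<and>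
        P s (fst (f (Suc s))) (snd (f (Suc s))))"
    proof (rule dependent_nat_choice)
      show "\<exists>x. I (fst x) (snd x)" using base by (intro exI[of _ "(0, init)"]) simp
      fix x s assume "I (fst x) (snd x)"
      from step[OF this, of s] show "\<exists>y. I (fst y) (snd y) \<and> fst x < fst y \<and>
          (\<forall>i<fst x. snd y i = snd x i) \<and> P s (fst y) (snd y)"
        by auto
    qed
    thus ?thesis by blast
  qed
  then obtain f where f: "\<And>s. I (fst (f (Suc s))) (snd (f (Suc s)))"
      "\<And>s. fst (f s) < fst (f (Suc s))"
      "\<And>s i. i < fst (f s) \<Longrightarrow> snd (f (Suc s)) i = snd (f s) i"
      "\<And>s. P s (fst (f (Suc s))) (snd (f (Suc s)))"
    by blast
  have ge: "s \<le> fst (f s)" for s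
    by (induction s) (use f(2) in \<open>auto intro: Suc_leI le_less_trans\<close>)
  have mono: "fst (f s) \<le> fst (f (s + d))" for s d
    by (induction d) (use f(2) in \<open>auto intro: order_trans less_imp_le\<close>)
  have agree: "snd (f (s + d)) i = snd (f s) i" if "i < fst (f s)" for s d i
  proof (induction d)
    case (Suc d)
    thus ?case using f(3)[of i "s + d"] mono[of s d] that by simp
  qed simp
  define z where "z = (\<lambda>i. snd (f (Suc i)) i)"
  have z: "z i = snd (f s) i" if "i < fst (f s)" for i s
  proof -
    have "i < fst (f (Suc i))" using ge[of "Suc i"] by simp
    thus ?thesis
      using agree[of i "Suc i" "s - Suc i"] agree[of i s "Suc i - s"] that
      by (cases "Suc i \<le> s") (auto simp: z_def)
  qed
  have "s < fst (f (Suc s)) \<and> I (fst (f (Suc s))) z \<and> P s (fst (f (Suc s))) z" for s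
    using ge[of "Suc s"] congI[OF f(1)[of s], of z] congP[OF f(4)[of s], of z] z by simp
  thus ?thesis by blast
qed

text \<open>Off \<open>A\<close> both sequences are filled in by one common \<open>z\<close> that
  serves the requirements of the two in turn. What was settled for one of them is only a finite
  modification for the other, and genericity tolerates these by definition.\<close>

lemma ex_generic_pair:
  assumes gen: "generic_on A D v1" "generic_on A D v2"
  shows "\<exists>u1 u2. generic D u1 \<and> generic D u2 \<and> (\<forall>i\<in>A. u1 i = v1 i \<and> u2 i = v2 i) \<and>
    (\<forall>i. i \<notin> A \<longrightarrow> u1 i = u2 i)"
proof -
  define mix where "mix = (\<lambda>b z i. if i \<in> A then (if b then v1 i else v2 i) else z i :: bool)"
  define P where "P = (\<lambda>s n z. case from_nat s of (b, k, r) \<Rightarrow>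
    \<exists>t. prefix r t \<and> D k t \<and> length t \<le> n \<and>
      (\<forall>i. length r \<le> i \<longrightarrow> i < length t \<longrightarrow> t ! i = mix b z i))"
  have "\<exists>z. \<forall>s. \<exists>n>s. True \<and> P s n z"
  proof (rule stagewise_construction[where I = "\<lambda>_ _. True" and P = P])
    fix s n and z :: "nat \<Rightarrow> bool"
    obtain b :: bool and k :: nat and r :: "bool list" where bkr: "from_nat s = (b, k, r)"
      by (metis prod_cases3)
    define N where "N = max (Suc n) (length r)"
    \<comment> \<open>\<open>r'\<close> continues \<open>r\<close> by the current values below
      \<open>N\<close>; an extension of it supplied by genericity on \<open>A\<close> then respects
      both the earlier stages and \<open>v1\<close> or \<open>v2\<close>.\<close>
    define r' where "r' = r @ map (mix b z) [length r..<N]"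
    have len: "length r' = N" by (simp add: r'_def N_def)
    have "generic_on A D (\<lambda>i. if b then v1 i else v2 i)" using gen by (cases b) auto
    then obtain t where t: "prefix r' t" "D k t"
        "\<And>i. i \<in> A \<Longrightarrow> length r' \<le> i \<Longrightarrow> i < length t \<Longrightarrow> t ! i = (if b then v1 i else v2 i)"
      unfolding generic_on_def by blast
    define z' where "z' = (\<lambda>i. if i < N then z i else if i < length t then t ! i else False)"
    have "prefix r t" using t(1) by (auto simp: r'_def prefix_def)
    moreover have "N \<le> length t" using prefix_length_le[OF t(1)] len by simp
    moreover have "t ! i = mix b z' i" if "length r \<le> i" "i < length t" for i
    proof (cases "i < N")
      case True
      hence "t ! i = r' ! i" using t(1) len by (auto simp: prefix_def nth_append)
      also have "\<dots> = mix b z i" using that True by (simp add: r'_def nth_append)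
      finally show ?thesis using True by (simp add: mix_def z'_def)
    next
      case False
      thus ?thesis using t(3)[of i] that len by (simp add: mix_def z'_def)
    qed
    ultimately have "P s (length t) z'" unfolding P_def bkr using t(2) by auto
    moreover have "n < length t" using \<open>N \<le> length t\<close> by (simp add: N_def)
    moreover have "\<forall>i<n. z' i = z i" by (auto simp: z'_def N_def)
    ultimately show "\<exists>n' z'. n < n' \<and> (\<forall>i<n. z' i = z i) \<and> True \<and> P s n' z'" by blast
  next
    fix s n and z z' :: "nat \<Rightarrow> bool"
    assume "P s n z" and z: "\<And>i. i < n \<Longrightarrow> z i = z' i"
    thus "P s n z'" unfolding P_def mix_def
      by (auto split: prod.splits)
  qed auto
  then obtain z where z: "\<And>s. \<exists>n. P s n z" by blast
  have "generic D (mix b z)" for b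
    unfolding generic_on_def
  proof (intro allI)
    fix k :: nat and r :: "bool list"
    from z[of "to_nat (b, k, r)"] show "\<exists>t. prefix r t \<and> D k t \<and>
       (\<forall>i\<in>UNIV. length r \<le> i \<longrightarrow> i < length t \<longrightarrow> t ! i = mix b z i)"
      by (auto simp: P_def)
  qed
  from this[of True] this[of False] show ?thesis
    by (intro exI[of _ "mix True z"] exI[of _ "mix False z"]) (auto simp: mix_def)
qed

text \<open>For \<open>A = {}\<close> the agreement clause of \<open>generic_on\<close> is void and
  only density remains.\<close>

lemma ex_generic: "dense_family D \<Longrightarrow> \<exists>u. generic D u"
  using ex_generic_pair[of "{}" D] by (auto simp: generic_on_def dense_family_def)

text \<open>\<open>b\<close> selects even or odd positions, giving two independent channels. The
  free index \<open>q\<close> offers infinitely many places for each bit \<open>j\<close>, so a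
  difference can always be postponed past a finite stage.\<close>

definition diff_code :: "nat \<Rightarrow> (nat \<Rightarrow> bool) \<Rightarrow> (nat \<Rightarrow> bool) \<Rightarrow> nat \<Rightarrow> bool" where
  "diff_code b u v = (\<lambda>j. \<exists>q. u (2 * prod_encode (j, q) + b) \<noteq> v (2 * prod_encode (j, q) + b))"

lemma diff_code_commute: "diff_code b u v = diff_code b v u"
  by (simp add: diff_code_def eq_commute)

text \<open>\<open>v\<close> copies \<open>u\<close> except for isolated flips at places of those
  \<open>j\<close> with \<open>a j\<close>. At each stage the part built so far is a finite
  modification of \<open>u\<close>, so a requirement can be met by continuing with bits of
  \<open>u\<close>; the flip comes only after that extension.\<close>

lemma ex_generic_diff_code:
  assumes gen: "generic D u" and b: "b < 2"
  shows "\<exists>v. generic D v \<and> diff_code b u v = a \<and> (\<forall>i. i mod 2 \<noteq> b \<longrightarrow> v i = u i)"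
proof -
  define I where "I = (\<lambda>n z. \<forall>i<n. z i \<noteq> u i \<longrightarrow> i mod 2 = b \<and> a (fst (prod_decode (i div 2))))"
  define P where "P = (\<lambda>s n z. case from_nat s of (k, r, j) \<Rightarrow>
    (\<exists>t. prefix r t \<and> D k t \<and> length t \<le> n \<and> (\<forall>i. length r \<le> i \<longrightarrow> i < length t \<longrightarrow> t ! i = z i)) \<and>
    (a j \<longrightarrow> (\<exists>q. 2 * prod_encode (j, q) + b < n \<and>
      u (2 * prod_encode (j, q) + b) \<noteq> z (2 * prod_encode (j, q) + b))))"
  have "\<exists>z. \<forall>s. \<exists>n>s. I n z \<and> P s n z"
  proof (rule stagewise_construction)
    fix s n and z :: "nat \<Rightarrow> bool" assume I: "I n z"
    obtain k j :: nat and r :: "bool list" where krj: "from_nat s = (k, r, j)" by (metis prod_cases3)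
    define N where "N = max n (length r)"
    define z1 where "z1 = (\<lambda>i. if i < n then z i else u i)"
    define r' where "r' = r @ map z1 [length r..<N]"
    have len: "length r' = N" by (simp add: r'_def N_def)
    obtain t where t: "prefix r' t" "D k t"
        "\<And>i. length r' \<le> i \<Longrightarrow> i < length t \<Longrightarrow> t ! i = u i"
      using gen unfolding generic_on_def by blast
    \<comment> \<open>The second component \<open>max n (length t)\<close> puts \<open>p\<close>
      behind both the settled part and \<open>t\<close>.\<close>
    define p where "p = 2 * prod_encode (j, max n (length t)) + b"
    have p: "n \<le> p" "length t \<le> p"
      using le_prod_encode_2[of "max n (length t)" j] by (auto simp: p_def)
    define z' where "z' = (if a j then z1(p := \<not> u p) else z1)"
    have "prefix r t" using t(1) by (auto simp: r'_def prefix_def)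
    moreover have "t ! i = z' i" if "length r \<le> i" "i < length t" for i
    proof (cases "i < N")
      case True
      hence "t ! i = r' ! i" using t(1) len by (auto simp: prefix_def nth_append)
      also have "\<dots> = z1 i" using that True by (simp add: r'_def nth_append)
      finally show ?thesis using p that by (auto simp: z'_def)
    next
      case False
      thus ?thesis using t(3)[of i] that len p by (auto simp: z1_def z'_def N_def)
    qed
    moreover have "a j \<longrightarrow> (\<exists>q. 2 * prod_encode (j, q) + b < Suc p \<and>
      u (2 * prod_encode (j, q) + b) \<noteq> z' (2 * prod_encode (j, q) + b))"
      unfolding z'_def p_def by (intro impI exI[of _ "max n (length t)"]) simp
    ultimately have "P s (Suc p) z'" unfolding P_def krj using t(2) p by auto
    moreover have "I (Suc p) z'"
    proof -
      have "p mod 2 = b" "p div 2 = prod_encode (j, max n (length t))"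
        using b by (simp_all add: p_def)
      thus ?thesis using I p by (auto simp: I_def z'_def z1_def)
    qed
    moreover have "\<forall>i<n. z' i = z i" using p by (auto simp: z'_def z1_def)
    ultimately show "\<exists>n' z'. n < n' \<and> (\<forall>i<n. z' i = z i) \<and> I n' z' \<and> P s n' z'"
      using p by (intro exI[of _ "Suc p"] exI[of _ z']) auto
  next
    show "I 0 u" by (simp add: I_def)
  next
    fix n and z z' :: "nat \<Rightarrow> bool"
    assume "I n z" "\<And>i. i < n \<Longrightarrow> z i = z' i"
    thus "I n z'" by (simp add: I_def)
  next
    fix s n and z z' :: "nat \<Rightarrow> bool"
    assume P: "P s n z" and z: "\<And>i. i < n \<Longrightarrow> z i = z' i"
    obtain k j :: nat and r :: "bool list" where krj: "from_nat s = (k, r, j)" by (metis prod_cases3)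
    from P obtain t where t: "prefix r t" "D k t" "length t \<le> n"
        "\<forall>i. length r \<le> i \<longrightarrow> i < length t \<longrightarrow> t ! i = z i"
      and j: "a j \<longrightarrow> (\<exists>q. 2 * prod_encode (j, q) + b < n \<and>
        u (2 * prod_encode (j, q) + b) \<noteq> z (2 * prod_encode (j, q) + b))"
      unfolding P_def krj prod.case by blast
    have "\<forall>i. length r \<le> i \<longrightarrow> i < length t \<longrightarrow> t ! i = z' i"
      using t z by simp
    with t j z show "P s n z'" unfolding P_def krj prod.case by blast
  qed
  then obtain z where z: "\<And>s. \<exists>n>s. I n z \<and> P s n z" by blast
  have I: "i mod 2 = b \<and> a (fst (prod_decode (i div 2)))" if "z i \<noteq> u i" for i
    using z[of i] that unfolding I_def by blast
  have P: "\<exists>n. P (to_nat (k, r, j)) n z" for k j :: nat and r :: "bool list"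
    using z by blast
  have "generic D z"
    unfolding generic_on_def
  proof (intro allI)
    fix k r
    show "\<exists>t. prefix r t \<and> D k t \<and> (\<forall>i\<in>UNIV. length r \<le> i \<longrightarrow> i < length t \<longrightarrow> t ! i = z i)"
      using P[of k r 0] by (auto simp: P_def)
  qed
  moreover have "diff_code b u z = a"
  proof
    fix j
    show "diff_code b u z j = a j"
    proof
      assume "diff_code b u z j"
      then obtain q where "u (2 * prod_encode (j, q) + b) \<noteq> z (2 * prod_encode (j, q) + b)"
        by (auto simp: diff_code_def)
      from I[OF this[symmetric]] b show "a j" by simp
    next
      assume "a j"
      thus "diff_code b u z j" using P[of 0 "[]" j] by (auto simp: P_def diff_code_def)
    qed
  qed
  ultimately show ?thesis using I by blast
qed

subsection \<open>Coded orders and the forcing relation\<close>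

text \<open>
  A real \<open>w\<close> codes an order \<open>wR w\<close> on the natural numbers, the children \<open>m\<close> with \<open>wK w n m\<close> and the
  literals \<open>i\<close> with \<open>wL w n i\<close> of each node \<open>n\<close>. When the order is a well-order, node \<open>n\<close> stands for
  the Borel set of all \<open>x\<close> that lie in the set of no smaller child of \<open>n\<close> and satisfy \<open>x i\<close> for no
  literal \<open>i\<close> of \<open>n\<close>. The greatest node \<open>0\<close> is kept free as a final stage above all the others.
\<close>

definition wR :: "(nat \<Rightarrow> bool) \<Rightarrow> nat \<Rightarrow> nat \<Rightarrow> bool" where
  "wR w m n \<longleftrightarrow> w (2 * prod_encode (m, n))"

definition wK :: "(nat \<Rightarrow> bool) \<Rightarrow> nat \<Rightarrow> nat \<Rightarrow> bool" where
  "wK w n m \<longleftrightarrow> w (4 * prod_encode (n, m) + 1)"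

definition wL :: "(nat \<Rightarrow> bool) \<Rightarrow> nat \<Rightarrow> nat \<Rightarrow> bool" where
  "wL w n i \<longleftrightarrow> w (4 * prod_encode (n, i) + 3)"

definition wpart :: "(nat \<Rightarrow> bool) \<Rightarrow> nat \<Rightarrow> bool" where "wpart x = (\<lambda>k. x (2 * k))"
definition upart :: "(nat \<Rightarrow> bool) \<Rightarrow> nat \<Rightarrow> bool" where "upart x = (\<lambda>k. x (2 * k + 1))"

lemma wpart_join [simp]: "wpart (w \<oplus>\<^sub>T u) = w" and upart_join [simp]: "upart (w \<oplus>\<^sub>T u) = u"
  unfolding wpart_def upart_def join_even join_odd by simp_all

lemma join_parts: "wpart x \<oplus>\<^sub>T upart x = x"
  by (auto simp: fun_eq_iff turing_join_def wpart_def upart_def)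

definition lin_top :: "(nat \<Rightarrow> bool) \<Rightarrow> bool" where
  "lin_top w \<longleftrightarrow> (\<forall>m. wR w m m) \<and> (\<forall>m n. wR w m n \<and> wR w n m \<longrightarrow> m = n) \<and>
    (\<forall>l m n. wR w l m \<and> wR w m n \<longrightarrow> wR w l n) \<and> (\<forall>m n. wR w m n \<or> wR w n m) \<and> (\<forall>m. wR w m 0)"

text \<open>The set without minimal element is given as a real \<open>z\<close>, so that
  ill-foundedness has witnesses that can be checked in a Borel way.\<close>

definition no_min :: "(nat \<Rightarrow> bool) \<Rightarrow> (nat \<Rightarrow> bool) \<Rightarrow> bool" where
  "no_min w z \<longleftrightarrow> (\<exists>n. z n) \<and> (\<forall>n. z n \<longrightarrow> (\<exists>m. z m \<and> wR w m n \<and> m \<noteq> n))"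

definition wo_top :: "(nat \<Rightarrow> bool) \<Rightarrow> bool" where
  "wo_top w \<longleftrightarrow> lin_top w \<and> (\<forall>z. \<not> no_min w z)"

lemma wo_top_induct [consumes 1, case_names less]:
  assumes "wo_top w" and "\<And>n. (\<And>m. wR w m n \<Longrightarrow> m \<noteq> n \<Longrightarrow> P m) \<Longrightarrow> P n"
  shows "P n"
proof (rule ccontr)
  assume "\<not> P n"
  hence "no_min w (\<lambda>n. \<not> P n)" unfolding no_min_def using assms(2) by blast
  thus False using assms(1) by (simp add: wo_top_def)
qed

text \<open>A literal concerns a bit of \<open>w \<oplus>\<^sub>T u\<close>: bits of
  \<open>w\<close> are known outright, bits of \<open>u\<close> only as far as the condition
  \<open>t\<close> reaches.\<close>

definition wleaf :: "(nat \<Rightarrow> bool) \<Rightarrow> bool list \<Rightarrow> nat \<Rightarrow> bool" where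
  "wleaf w t i \<longleftrightarrow> (if even i then w (i div 2) else i div 2 < length t \<and> t ! (i div 2))"

definition forced :: "(nat \<Rightarrow> bool) \<Rightarrow> nat \<Rightarrow> bool list \<Rightarrow> bool" where
  "forced H n t \<longleftrightarrow> H (prod_encode (n, to_nat t))"

definition kid_forced :: "(nat \<Rightarrow> bool) \<Rightarrow> (nat \<Rightarrow> bool) \<Rightarrow> nat \<Rightarrow> nat \<Rightarrow> bool list \<Rightarrow> bool" where
  "kid_forced w H n m t \<longleftrightarrow>
    (wK w n m \<and> wR w m n \<and> m \<noteq> n \<and> forced H m t) \<or> (wL w n m \<and> wleaf w t m)"

text \<open>A node denotes an intersection of complements, so it is forced when no extension forces
  a child or a literal. Node 0 gets the default False, which leaves stage 0 free to collect all
  other rows. The clause ranges over every number \<open>s\<close>, so that a solution is pinned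
  down at all arguments.\<close>

definition forcing :: "(nat \<Rightarrow> bool) \<Rightarrow> (nat \<Rightarrow> bool) \<Rightarrow> bool" where
  "forcing w H \<longleftrightarrow> (\<forall>n s. H (prod_encode (n, s)) \<longleftrightarrow>
     n \<noteq> 0 \<and> (\<forall>t. prefix (from_nat s) t \<longrightarrow> (\<forall>m. \<not> kid_forced w H n m t)))"

lemma forced_iff:
  assumes "forcing w H" "n \<noteq> 0"
  shows "forced H n s \<longleftrightarrow> (\<forall>t m. prefix s t \<longrightarrow> \<not> kid_forced w H n m t)"
  using assms unfolding forcing_def forced_def by auto

lemma forced_mono:
  assumes H: "forcing w H" and s: "forced H n s" "prefix s t"
  shows "forced H n t"
proof -
  have "n \<noteq> 0" using H s(1) by (auto simp: forcing_def forced_def)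
  thus ?thesis using s forced_iff[OF H] prefix_order.trans by metis
qed

lemma forcing_unique:
  assumes "wo_top w" "forcing w H" "forcing w H'"
  shows "H = H'"
proof -
  have "\<forall>s. H (prod_encode (n, s)) = H' (prod_encode (n, s))" for n
    using assms(1)
  proof (induction n rule: wo_top_induct)
    case (less n)
    hence "kid_forced w H n m t = kid_forced w H' n m t" for m t
      unfolding kid_forced_def forced_def by blast
    thus ?case using assms(2,3) unfolding forcing_def by simp
  qed
  hence "H k = H' k" for k
    by (metis prod.collapse prod_decode_inverse)
  thus ?thesis by blast
qed

text \<open>
  The sets with index \<open>Inl n\<close> decide node \<open>n + 1\<close>. Those with index \<open>Inr p\<close> serve the
  diagonalisation against the \<open>p\<close>-th program.
\<close>

definition target :: "nat \<Rightarrow> bool list \<Rightarrow> nat" where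
  "target k s = (case sum_decode k of Inl n \<Rightarrow> Suc n
    | Inr p \<Rightarrow> Suc (prod_encode (prod_encode (p, to_nat s), 0)))"

text \<open>For \<open>Inl n\<close> the target ignores \<open>s\<close>. For \<open>Inr p\<close>
  the string \<open>s\<close> also names the input at which the program is to be refuted: an initial
  segment is sought that settles its own input.\<close>

definition decides :: "(nat \<Rightarrow> bool) \<Rightarrow> (nat \<Rightarrow> bool) \<Rightarrow> nat \<Rightarrow> bool list \<Rightarrow> bool" where
  "decides w H k t \<longleftrightarrow> (\<exists>s m. prefix s t \<and>
    (forced H (target k s) s \<or> kid_forced w H (target k s) m t))"

lemma target_nonzero [simp]: "target k s \<noteq> 0"
  by (simp add: target_def split: sum.splits)

lemma dense_decides:
  assumes "forcing w H"
  shows "dense_family (decides w H)"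
  unfolding dense_family_def
proof (intro allI)
  fix k r
  show "\<exists>t. prefix r t \<and> decides w H k t"
  proof (cases "forced H (target k r) r")
    case True
    thus ?thesis by (intro exI[of _ r]) (auto simp: decides_def)
  next
    case False
    then obtain t m where "prefix r t" "kid_forced w H (target k r) m t"
      using forced_iff[OF assms target_nonzero] by blast
    thus ?thesis by (auto simp: decides_def)
  qed
qed

section \<open>Truth lemma and diagonalisation\<close>

lemma generic_meets:
  assumes "generic D u"
  shows "\<exists>l. D k (map u [0..<l])"
proof -
  obtain t where "D k t" "\<And>i. i < length t \<Longrightarrow> t ! i = u i"
    using assms unfolding generic_on_def by (metis UNIV_I le0 list.size(3))
  moreover from this(2) have "map u [0..<length t] = t" by (intro nth_equalityI) auto
  ultimately show ?thesis by metis
qed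

lemma prefix_map_upt: "prefix s (map u [0..<l]) \<longleftrightarrow> (\<exists>l'\<le>l. s = map u [0..<l'])"
proof
  assume *: "prefix s (map u [0..<l])"
  hence "s = take (length s) (map u [0..<l])" by (auto simp: prefix_def)
  moreover have "length s \<le> l" using prefix_length_le[OF *] by simp
  ultimately show "\<exists>l'\<le>l. s = map u [0..<l']"
    by (intro exI[of _ "length s"]) (simp add: take_map)
next
  assume "\<exists>l'\<le>l. s = map u [0..<l']"
  then obtain l' where "l' \<le> l" "s = map u [0..<l']" by blast
  thus "prefix s (map u [0..<l])"
    using take_is_prefix[of l' "map u [0..<l]"] by (simp add: take_map)
qed

definition node_sets :: "(nat \<Rightarrow> bool) \<Rightarrow> (nat \<Rightarrow> (nat \<Rightarrow> bool) set) \<Rightarrow> bool" where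
  "node_sets w B \<longleftrightarrow> (\<forall>n. B n = {x. \<not> (\<exists>m. wK w n m \<and> wR w m n \<and> m \<noteq> n \<and> x \<in> B m) \<and>
     \<not> (\<exists>i. wL w n i \<and> x i)})"

lemma wleaf_imp: "wleaf w (map u [0..<l]) i \<Longrightarrow> (w \<oplus>\<^sub>T u) i"
  by (auto simp: wleaf_def turing_join_def split: if_splits)

lemma ex_wleaf: "(w \<oplus>\<^sub>T u) i \<Longrightarrow> i < l \<Longrightarrow> wleaf w (map u [0..<l]) i"
  by (auto simp: wleaf_def turing_join_def split: if_splits)

text \<open>Induction along the coded order. Genericity for the index \<open>Inl (n - 1)\<close>
  supplies a decision about node \<open>n\<close>, and a forced child or literal contradicts
  membership. Conversely, a forced node and a true child or literal would clash at a common longer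
  initial segment, by \<open>forced_mono\<close>.\<close>

lemma truth_lemma:
  assumes w: "wo_top w" "node_sets w B" and H: "forcing w H" and u: "generic (decides w H) u"
    and n: "n \<noteq> 0"
  shows "w \<oplus>\<^sub>T u \<in> B n \<longleftrightarrow> (\<exists>l. forced H n (map u [0..<l]))"
  using w(1) n
proof (induction n rule: wo_top_induct)
  case (less n)
  let ?x = "w \<oplus>\<^sub>T u"
  have kid: "m \<noteq> 0" if "wR w m n" "m \<noteq> n" for m
    using w(1) that unfolding wo_top_def lin_top_def by metis
  have B: "?x \<in> B n \<longleftrightarrow> \<not> (\<exists>m. wK w n m \<and> wR w m n \<and> m \<noteq> n \<and> ?x \<in> B m) \<and> \<not> (\<exists>i. wL w n i \<and> ?x i)"
    using w(2) unfolding node_sets_def by blast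
  have kid_true: "?x \<notin> B n" if "kid_forced w H n m (map u [0..<l])" for m l
    using that less.IH[of m] kid[of m] wleaf_imp[of w u l m] unfolding kid_forced_def B by blast
  show ?case
  proof
    assume x: "?x \<in> B n"
    obtain l where "decides w H (sum_encode (Inl (n - 1))) (map u [0..<l])"
      using generic_meets[OF u] by blast
    then obtain s m where s: "prefix s (map u [0..<l])"
        "forced H n s \<or> kid_forced w H n m (map u [0..<l])"
      using less.prems by (auto simp: decides_def target_def)
    thus "\<exists>l. forced H n (map u [0..<l])"
      using kid_true[of m l] x by (auto simp: prefix_map_upt)
  next
    assume "\<exists>l. forced H n (map u [0..<l])"
    then obtain l where l: "forced H n (map u [0..<l])" ..
    have no: "\<not> kid_forced w H n m (map u [0..<l'])" if "l \<le> l'" for m l'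
      using l that forced_iff[OF H less.prems] by (metis prefix_map_upt)
    show "?x \<in> B n"
      unfolding B
    proof (intro conjI notI; elim exE conjE)
      fix m assume m: "wK w n m" "wR w m n" "m \<noteq> n" "?x \<in> B m"
      then obtain l' where "forced H m (map u [0..<l'])" using less.IH kid by blast
      hence "forced H m (map u [0..<max l l'])"
        using forced_mono[OF H] by (metis max.cobounded2 prefix_map_upt)
      thus False using no[of "max l l'" m] m by (simp add: kid_forced_def)
    next
      fix i assume "wL w n i" "?x i"
      thus False using no[of "max l (Suc i)" i] ex_wleaf[of w u i "max l (Suc i)"]
        by (simp add: kid_forced_def)
    qed
  qed
qed

text \<open>Genericity for \<open>Inr p\<close> yields an initial segment \<open>s\<close> that
  either forces the node of its own input, or lies below a segment forcing a child or literal of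
  that node. At this input membership therefore coincides with being forced by \<open>s\<close>,
  which is what \<open>a\<close> negates. Since \<open>a\<close> mentions \<open>H\<close> but not
  \<open>u\<close>, it defeats all generic \<open>u\<close> at once.\<close>

lemma diagonal:
  assumes w: "wo_top w" "node_sets w B" and H: "forcing w H" and u: "generic (decides w H) u"
    and a: "\<And>n. a n \<longleftrightarrow> \<not> forced H (Suc (prod_encode (n, 0))) (from_nat (snd (prod_decode n)))"
  shows "\<exists>s. (w \<oplus>\<^sub>T u \<in> B (Suc (prod_encode (prod_encode (p, s), 0)))) \<noteq> a (prod_encode (p, s))"
proof -
  obtain l where "decides w H (sum_encode (Inr p)) (map u [0..<l])"
    using generic_meets[OF u] by blast
  then obtain s m where s: "prefix s (map u [0..<l])"
      "forced H (target (sum_encode (Inr p)) s) s \<or>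
       kid_forced w H (target (sum_encode (Inr p)) s) m (map u [0..<l])"
    by (auto simp: decides_def)
  define n where "n = Suc (prod_encode (prod_encode (p, to_nat s), 0))"
  have t: "target (sum_encode (Inr p)) s = n" by (simp add: target_def n_def)
  have a': "a (prod_encode (p, to_nat s)) \<longleftrightarrow> \<not> forced H n s"
    by (simp add: a n_def)
  note truth = truth_lemma[OF w H u, of n]
  obtain l' where l': "s = map u [0..<l']" using s(1) by (auto simp: prefix_map_upt)
  have "w \<oplus>\<^sub>T u \<notin> B n" if k: "kid_forced w H n m (map u [0..<l])"
  proof
    assume "w \<oplus>\<^sub>T u \<in> B n"
    have "w \<oplus>\<^sub>T u \<in> B n \<longleftrightarrow>
        \<not> (\<exists>m. wK w n m \<and> wR w m n \<and> m \<noteq> n \<and> w \<oplus>\<^sub>T u \<in> B m) \<and> \<not> (\<exists>i. wL w n i \<and> (w \<oplus>\<^sub>T u) i)"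
      using w(2) unfolding node_sets_def by blast
    moreover have "m \<noteq> 0" if "wR w m n" "m \<noteq> n"
      using w(1) that unfolding wo_top_def lin_top_def by metis
    ultimately show False
      using k \<open>w \<oplus>\<^sub>T u \<in> B n\<close> truth_lemma[OF w H u, of m] wleaf_imp[of w u l m]
      unfolding kid_forced_def by blast
  qed
  hence "(w \<oplus>\<^sub>T u \<in> B n) \<noteq> a (prod_encode (p, to_nat s))"
    using s(2) a' truth l' unfolding t by (auto simp: n_def)
  thus ?thesis unfolding n_def by blast
qed

subsection \<open>Coding a real into a generic sequence\<close>

text \<open>
  \<open>ext_step w H s r v\<close> says that \<open>v\<close> codes an extension of \<open>r\<close> meeting the \<open>s\<close>-th genericity
  requirement, with all witnesses, so that it depends on finitely many bits of \<open>w\<close> and \<open>H\<close> only.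
\<close>

definition ext_step :: "(nat \<Rightarrow> bool) \<Rightarrow> (nat \<Rightarrow> bool) \<Rightarrow> nat \<Rightarrow> bool list \<Rightarrow> nat \<Rightarrow> bool" where
  "ext_step w H s r v \<longleftrightarrow> (case from_nat s of (k :: nat, r0) \<Rightarrow> case from_nat v of (r', t, q, m) \<Rightarrow>
     prefix r r' \<and> prefix r0 t \<and> length t \<le> length r' \<and>
     (\<forall>i. length r0 \<le> i \<longrightarrow> i < length t \<longrightarrow> t ! i = r' ! i) \<and> prefix q t \<and>
     (forced H (target k q) q \<or> kid_forced w H (target k q) m t))"

text \<open>Taking the least code makes the extension canonical: a decoder that knows
  \<open>w\<close> and \<open>H\<close> repeats the choice of the encoder.\<close>

definition ext :: "(nat \<Rightarrow> bool) \<Rightarrow> (nat \<Rightarrow> bool) \<Rightarrow> nat \<Rightarrow> bool list \<Rightarrow> bool list" where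
  "ext w H s r = (case from_nat (LEAST v. ext_step w H s r v) of (r' :: bool list, _ :: bool list, _ :: bool list, _ :: nat) \<Rightarrow> r')"

lemma nth_prefix: "prefix r t \<Longrightarrow> i < length r \<Longrightarrow> t ! i = r ! i"
  by (auto simp: prefix_def nth_append)

lemma ex_ext_step:
  assumes "dense_family (decides w H)"
  shows "\<exists>v. ext_step w H s r v"
proof -
  obtain k :: nat and r0 :: "bool list" where k: "from_nat s = (k, r0)" by fastforce
  define N where "N = max (length r) (length r0)"
  \<comment> \<open>\<open>r0\<close> is to be prolonged by the bits of \<open>r\<close> up to the
    longer of the two lengths; the value False past \<open>r\<close> is never read.\<close>
  define z where "z = (\<lambda>i. i < length r \<and> r ! i)"
  obtain t where t: "prefix (r0 @ map z [length r0..<N]) t" "decides w H k t"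
    using assms unfolding dense_family_def by blast
  then obtain q m where q: "prefix q t" "forced H (target k q) q \<or> kid_forced w H (target k q) m t"
    unfolding decides_def by blast
  have N: "N \<le> length t" using prefix_length_le[OF t(1)] by (simp add: N_def)
  define r' where "r' = map (\<lambda>i. if i < length r then r ! i else t ! i) [0..<length t]"
  have "prefix r r'"
  proof -
    have "take (length r) r' = r"
      using N by (intro nth_equalityI) (auto simp: r'_def N_def)
    thus ?thesis by (metis take_is_prefix)
  qed
  moreover have "t ! i = r' ! i" if "length r0 \<le> i" "i < length t" for i
  proof (cases "i < N")
    case True
    hence "t ! i = (r0 @ map z [length r0..<N]) ! i"
      by (intro nth_prefix[OF t(1)]) (simp add: N_def)
    hence "t ! i = z i" using that True by (simp add: nth_append)
    thus ?thesis using that True by (auto simp: r'_def z_def N_def nth_append)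
  next
    case False
    thus ?thesis using that by (auto simp: r'_def N_def)
  qed
  moreover have "prefix r0 t" using t(1) by (auto simp: prefix_def)
  moreover have "length t \<le> length r'" by (simp add: r'_def)
  ultimately have "ext_step w H s r (to_nat (r', t, q, m))"
    using q by (simp add: ext_step_def k)
  thus ?thesis ..
qed

lemma ext_properties:
  assumes "dense_family (decides w H)"
  shows "prefix r (ext w H s r)" (is ?A)
    and "from_nat s = (k, r0) \<Longrightarrow> \<exists>t. prefix r0 t \<and> decides w H k t \<and> length t \<le> length (ext w H s r) \<and>
      (\<forall>i. length r0 \<le> i \<longrightarrow> i < length t \<longrightarrow> t ! i = ext w H s r ! i)" (is "_ \<Longrightarrow> ?B")
proof -
  define v where "v = (LEAST v. ext_step w H s r v)"
  have *: "ext_step w H s r v"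
    using ex_ext_step[OF assms] unfolding v_def by (rule LeastI_ex)
  obtain r' t q :: "bool list" and m :: nat where v: "from_nat v = (r', t, q, m)"
    by (metis prod_cases4)
  have e: "ext w H s r = r'" by (simp add: ext_def v flip: v_def)
  show ?A using *[unfolded ext_step_def v] by (simp add: e split: prod.splits)
  show ?B if "from_nat s = (k, r0)"
    using *[unfolded ext_step_def v that] by (auto simp: e decides_def)
qed

text \<open>This is the string built before bit \<open>s\<close> is inserted. The bit of
  \<open>u\<close> right behind it is the coded one; then the genericity extension is
  replayed.\<close>

primrec decode_at :: "(nat \<Rightarrow> bool) \<Rightarrow> (nat \<Rightarrow> bool) \<Rightarrow> (nat \<Rightarrow> bool) \<Rightarrow> nat \<Rightarrow> bool list" where
  "decode_at w H u 0 = []"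
| "decode_at w H u (Suc s) = ext w H s (decode_at w H u s @ [u (length (decode_at w H u s))])"

definition decode :: "(nat \<Rightarrow> bool) \<Rightarrow> (nat \<Rightarrow> bool) \<Rightarrow> (nat \<Rightarrow> bool) \<Rightarrow> nat \<Rightarrow> bool" where
  "decode w H u = (\<lambda>s. u (length (decode_at w H u s)))"

text \<open>Coding alternates one payload bit \<open>a s\<close> with an extension meeting
  requirement \<open>s\<close>. As \<open>s\<close> runs through all pairs of an index and a finite
  modification, the limit is generic, and by induction the decoder retraces the same
  strings.\<close>

lemma ex_generic_decode:
  assumes D: "dense_family (decides w H)"
  shows "\<exists>u. generic (decides w H) u \<and> decode w H u = a"
proof -
  define enc where "enc = rec_nat [] (\<lambda>s r. ext w H s (r @ [a s]))"
  have enc: "enc 0 = []" "enc (Suc s) = ext w H s (enc s @ [a s])" for s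
    by (simp_all add: enc_def)
  have pre: "prefix (enc s @ [a s]) (enc (Suc s))" for s
    unfolding enc by (rule ext_properties(1)[OF D])
  have chain: "prefix (enc s) (enc (s + d))" for s d
  proof (induction d)
    case (Suc d)
    thus ?case using pre[of "s + d"] by (auto simp: prefix_def)
  qed simp
  have len: "s \<le> length (enc s)" for s
  proof (induction s)
    case (Suc s)
    thus ?case using prefix_length_le[OF pre[of s]] by simp
  qed simp
  define u where "u = (\<lambda>i. enc (Suc i) ! i)"
  have u: "enc s ! i = u i" if "i < length (enc s)" for s i
  proof -
    have i: "i < length (enc (Suc i))" using len[of "Suc i"] by simp
    show ?thesis
      using chain[of s "Suc i - s"] chain[of "Suc i" "s - Suc i"] that i
      by (cases "Suc i \<le> s") (auto simp: u_def prefix_def nth_append)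
  qed
  have ua: "u (length (enc s)) = a s" for s
    using u[of "length (enc s)" "Suc s"] pre[of s] by (auto simp: prefix_def nth_append)
  have "decode_at w H u s = enc s" for s
    by (induction s) (simp_all add: enc ua)
  hence "decode w H u = a" by (simp add: decode_def ua)
  moreover have "generic (decides w H) u"
    unfolding generic_on_def
  proof (intro allI)
    fix k r
    obtain t where "prefix r t" "decides w H k t"
        "length t \<le> length (enc (Suc (to_nat (k, r))))"
        "\<And>i. length r \<le> i \<Longrightarrow> i < length t \<Longrightarrow> t ! i = enc (Suc (to_nat (k, r))) ! i"
      using ext_properties(2)[OF D, of "to_nat (k, r)" k r] unfolding enc by fastforce
    thus "\<exists>t. prefix r t \<and> decides w H k t \<and>
        (\<forall>i\<in>UNIV. length r \<le> i \<longrightarrow> i < length t \<longrightarrow> t ! i = u i)"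
      using u by (intro exI[of _ t]) auto
  qed
  ultimately show ?thesis by blast
qed

section \<open>Continuity of decoding\<close>

lemma eventually_Least_eq:
  assumes ev: "\<And>v::nat. \<forall>\<^sub>F x in F. P x v = Q v" and ex: "\<exists>v. Q v"
  shows "\<forall>\<^sub>F x in F. (LEAST v. P x v) = (LEAST v. Q v)"
proof -
  have "\<forall>\<^sub>F x in F. \<forall>v\<in>{..LEAST v. Q v}. P x v = Q v"
    by (intro eventually_ball_finite) (auto intro: ev)
  thus ?thesis
  proof eventually_elim
    case (elim x)
    show ?case
    proof (rule Least_equality)
      show "P x (LEAST v. Q v)" using elim LeastI_ex[OF ex] by auto
      fix v assume "P x v"
      thus "(LEAST v. Q v) \<le> v"
        using elim by (cases "v \<le> (LEAST v. Q v)") (auto intro: Least_le)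
    qed
  qed
qed

context
  fixes F :: "'a filter" and w H :: "'a \<Rightarrow> nat \<Rightarrow> bool" and w0 H0 :: "nat \<Rightarrow> bool"
  assumes w: "\<And>i. \<forall>\<^sub>F x in F. w x i = w0 i"
    and H: "\<And>i. \<forall>\<^sub>F x in F. H x i = H0 i"
begin

lemma eventually_kid_forced_eq:
  "\<forall>\<^sub>F x in F. kid_forced (w x) (H x) n m t = kid_forced w0 H0 n m t"
  using w[of "2 * prod_encode (m, n)"] w[of "4 * prod_encode (n, m) + 1"]
    w[of "4 * prod_encode (n, m) + 3"] w[of "m div 2"] H[of "prod_encode (m, to_nat t)"]
  by eventually_elim (simp add: kid_forced_def wR_def wK_def wL_def wleaf_def forced_def)

lemma eventually_ext_step_eq: "\<forall>\<^sub>F x in F. ext_step (w x) (H x) s r v = ext_step w0 H0 s r v"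
proof -
  obtain k :: nat and r0 :: "bool list" where k: "from_nat s = (k, r0)" by fastforce
  obtain r' t q :: "bool list" and m :: nat where v: "from_nat v = (r', t, q, m)"
    by (metis prod_cases4)
  from eventually_kid_forced_eq[of "target k q" m t] H[of "prod_encode (target k q, to_nat q)"]
  show ?thesis
    by eventually_elim (simp add: ext_step_def k v forced_def)
qed

text \<open>Density makes every search for a least code stop, and then only finitely many bits of
  \<open>w\<close>, \<open>H\<close> and \<open>u\<close> have been used.\<close>

lemma eventually_decode_eq:
  assumes u: "\<And>i. \<forall>\<^sub>F x in F. u x i = u0 i" and D: "dense_family (decides w0 H0)"
  shows "\<forall>\<^sub>F x in F. decode (w x) (H x) (u x) s = decode w0 H0 u0 s"
proof -
  have at: "\<forall>\<^sub>F x in F. decode_at (w x) (H x) (u x) s = decode_at w0 H0 u0 s" for s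
  proof (induction s)
    case (Suc s)
    let ?r = "decode_at w0 H0 u0 s @ [u0 (length (decode_at w0 H0 u0 s))]"
    from Suc u[of "length (decode_at w0 H0 u0 s)"]
      eventually_Least_eq[of "\<lambda>x. ext_step (w x) (H x) s ?r" "ext_step w0 H0 s ?r",
        OF eventually_ext_step_eq ex_ext_step[OF D]]
    show ?case by eventually_elim (simp add: ext_def)
  qed simp
  from at[of s] u[of "length (decode_at w0 H0 u0 s)"] show ?thesis
    by eventually_elim (simp add: decode_def)
qed

end

subsection \<open>Hyperarithmetic decoding\<close>

definition wrel :: "(nat \<Rightarrow> bool) \<Rightarrow> nat rel" where "wrel w = {(m, n). wR w m n}"

lemma Field_wrel:
  assumes "lin_top w"
  shows "Field (wrel w) = UNIV"
proof -
  have "(n, n) \<in> wrel w" for n using assms unfolding wrel_def lin_top_def by blast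
  thus ?thesis by (auto intro: FieldI1)
qed

lemma wf_wrel:
  assumes "wo_top w"
  shows "wf (wrel w - Id)"
proof (rule wfUNIVI)
  fix P n assume "\<forall>n. (\<forall>m. (m, n) \<in> wrel w - Id \<longrightarrow> P m) \<longrightarrow> P n"
  thus "P n" using wo_top_induct[OF assms, of P n] by (auto simp: wrel_def)
qed

lemma Well_order_wrel:
  assumes "wo_top w"
  shows "Well_order (wrel w)"
proof -
  have lin: "lin_top w" using assms by (simp add: wo_top_def)
  have "refl_on UNIV (wrel w)" "trans (wrel w)" "antisym (wrel w)" "total_on UNIV (wrel w)"
    using lin unfolding lin_top_def wrel_def refl_on_def trans_def antisym_def total_on_def by blast+
  thus ?thesis
    using wf_wrel[OF assms] Field_wrel[OF lin]
    by (simp add: well_order_on_def linear_order_on_def partial_order_on_def preorder_on_def)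
qed

text \<open>
  The tags of \<open>table_index\<close>: \<open>0\<close> for the forcing relation, \<open>1\<close> for the real coded by a generic
  sequence, \<open>2\<close> and \<open>3\<close> for the two halves of the second part of \<open>y\<close>, and \<open>n + 4\<close> for the
  negation of the forcing relation at node \<open>n\<close>. Position \<open>4 k + 2\<close> of the stage oracle
  \<open>(y \<oplus>\<^sub>T c) \<oplus>\<^sub>T Z\<close> holds \<open>c k\<close>.
\<close>

definition oidx :: "nat \<Rightarrow> nat \<Rightarrow> nat" where
  "oidx t i = table_index 4 2 (prod_encode (t, i))"

text \<open>A jump answers whether some extension forces a child or literal, so its negation is
  wanted. Rows of nodes not yet available come out True for \<open>n \<noteq> 0\<close>, which is
  harmless because \<open>kid_forced\<close> looks at smaller nodes only.\<close>

definition stage_forcing :: "(nat \<Rightarrow> bool) \<Rightarrow> nat \<Rightarrow> bool" where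
  "stage_forcing Z = (\<lambda>k. case prod_decode k of (n, s) \<Rightarrow> n \<noteq> 0 \<and> \<not> Z (prod_encode (n, oidx (n + 4) s)))"

definition stage_pred :: "nat \<Rightarrow> (nat \<Rightarrow> bool) \<Rightarrow> (nat \<Rightarrow> bool) \<Rightarrow> bool" where
  "stage_pred j y Z = (case prod_decode j of (t, i) \<Rightarrow>
     if t = 0 then stage_forcing Z i
     else if t = 1 then decode (wpart y) (stage_forcing Z) (upart y) i
     else if t = 2 then upart y (2 * i)
     else if t = 3 then upart y (2 * i + 1)
     else \<exists>r m. prefix (from_nat i) r \<and> kid_forced (wpart y) (stage_forcing Z) (t - 4) m r)"

lemma open_eventually_nhds: "open {x. \<forall>\<^sub>F y in nhds x. P y}"
proof (rule topological_space_class.openI)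
  fix x assume "x \<in> {x. \<forall>\<^sub>F y in nhds x. P y}"
  then obtain S where S: "open S" "x \<in> S" "\<forall>y\<in>S. P y" unfolding eventually_nhds by blast
  hence "S \<subseteq> {x. \<forall>\<^sub>F y in nhds x. P y}" unfolding eventually_nhds by blast
  with S show "\<exists>T. open T \<and> x \<in> T \<and> T \<subseteq> {x. \<forall>\<^sub>F y in nhds x. P y}" by blast
qed

lemma stage_oracle:
  defines "yof \<equiv> \<lambda>X :: nat \<Rightarrow> bool. \<lambda>k. X (4 * k)" and "zof \<equiv> \<lambda>X :: nat \<Rightarrow> bool. \<lambda>k. X (2 * k + 1)"
  shows "\<exists>c. \<forall>y Z t i. (t = 1 \<longrightarrow> dense_family (decides (wpart y) (stage_forcing Z))) \<longrightarrow>
    (turing_jump ((y \<oplus>\<^sub>T c) \<oplus>\<^sub>T Z) (oidx t i) \<longleftrightarrow> stage_pred (prod_encode (t, i)) y Z)"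
proof -
  \<comment> \<open>The interior of a predicate is open whatever the predicate. It loses nothing at
    points where truth persists nearby, which for decoding is ensured by density.\<close>
  let ?V = "\<lambda>j. {X. \<forall>\<^sub>F X' in nhds X. stage_pred j (yof X') (zof X')}"
  obtain c where c: "\<And>X j. (\<And>k. X (4 * k + 2) = c k) \<Longrightarrow>
      turing_jump X (table_index 4 2 j) \<longleftrightarrow> X \<in> ?V j"
    using jump_table[of ?V 4 2, OF open_eventually_nhds] by blast
  have "turing_jump ((y \<oplus>\<^sub>T c) \<oplus>\<^sub>T Z) (oidx t i) \<longleftrightarrow> stage_pred (prod_encode (t, i)) y Z"
    if D: "t = 1 \<longrightarrow> dense_family (decides (wpart y) (stage_forcing Z))" for y Z t i
  proof -
    define X where "X = (y \<oplus>\<^sub>T c) \<oplus>\<^sub>T Z"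
    have y: "yof X = y" and z: "zof X = Z"
      by (auto simp: X_def yof_def zof_def turing_join_def)
    have "X (4 * k + 2) = c k" for k
      using join_even[of "y \<oplus>\<^sub>T c" Z "2 * k + 1"] join_odd[of y c k] by (simp add: X_def)
    from c[OF this] have J: "turing_jump X (oidx t i) \<longleftrightarrow> X \<in> ?V (prod_encode (t, i))"
      by (simp add: oidx_def)
    have ev_y: "\<forall>\<^sub>F X' in nhds X. wpart (yof X') k = wpart y k"
      and ev_u: "\<forall>\<^sub>F X' in nhds X. upart (yof X') k = upart y k"
      and ev_H: "\<forall>\<^sub>F X' in nhds X. stage_forcing (zof X') k = stage_forcing Z k" for k
    proof -
      have *: "\<forall>\<^sub>F X' in nhds X. yof X' k = y k" "\<forall>\<^sub>F X' in nhds X. zof X' k = Z k" for k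
        unfolding y[symmetric] z[symmetric] by (simp_all add: yof_def zof_def eventually_nhds_bit)
      show "\<forall>\<^sub>F X' in nhds X. wpart (yof X') k = wpart y k"
        "\<forall>\<^sub>F X' in nhds X. upart (yof X') k = upart y k"
        using * by (simp_all add: wpart_def upart_def)
      obtain n s where k: "prod_decode k = (n, s)" by fastforce
      from *(2)[of "prod_encode (n, oidx (n + 4) s)"]
      show "\<forall>\<^sub>F X' in nhds X. stage_forcing (zof X') k = stage_forcing Z k"
        by eventually_elim (simp add: stage_forcing_def k)
    qed
    have "X \<in> ?V (prod_encode (t, i)) \<longleftrightarrow> stage_pred (prod_encode (t, i)) y Z"
    proof
      assume "X \<in> ?V (prod_encode (t, i))"
      hence "stage_pred (prod_encode (t, i)) (yof X) (zof X)"
        by (auto dest: eventually_nhds_x_imp_x)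
      thus "stage_pred (prod_encode (t, i)) y Z" by (simp add: y z)
    next
      assume P: "stage_pred (prod_encode (t, i)) y Z"
      consider "t = 0" | "t = 1" | "t = 2" | "t = 3" | "t \<ge> 4" by linarith
      hence "\<forall>\<^sub>F X' in nhds X. stage_pred (prod_encode (t, i)) (yof X') (zof X')"
      proof cases
        case 1
        from ev_H[of i] show ?thesis by eventually_elim (use P 1 in \<open>simp add: stage_pred_def\<close>)
      next
        case 2
        with D have "dense_family (decides (wpart y) (stage_forcing Z))" by blast
        from eventually_decode_eq[where w = "\<lambda>X. wpart (yof X)" and H = "\<lambda>X. stage_forcing (zof X)"
          and u = "\<lambda>X. upart (yof X)", OF ev_y ev_H ev_u this, where s = i]
        show ?thesis by eventually_elim (use P 2 in \<open>simp add: stage_pred_def\<close>)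
      next
        case 3
        from ev_u[of "2 * i"] show ?thesis by eventually_elim (use P 3 in \<open>simp add: stage_pred_def\<close>)
      next
        case 4
        from ev_u[of "2 * i + 1"] show ?thesis by eventually_elim (use P 4 in \<open>simp add: stage_pred_def\<close>)
      next
        case 5
        then obtain r m where rm: "prefix (from_nat i) r"
            "kid_forced (wpart y) (stage_forcing Z) (t - 4) m r"
          using P by (auto simp: stage_pred_def)
        from eventually_kid_forced_eq[where w = "\<lambda>X. wpart (yof X)"
            and H = "\<lambda>X. stage_forcing (zof X)", OF ev_y ev_H, where n = "t - 4" and m = m and t = r]
        show ?thesis by eventually_elim (use rm 5 in \<open>auto simp: stage_pred_def\<close>)
      qed
      thus "X \<in> ?V (prod_encode (t, i))" by simp
    qed
    thus ?thesis using J by (simp add: X_def)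
  qed
  thus ?thesis by blast
qed

text \<open>One jump suffices: the order on the single point 0 has one stage, whose oracle is
  \<open>y\<close> joined with the empty set.\<close>

lemma hyp_le_singleton:
  assumes "\<And>i. a i = turing_jump (y \<oplus>\<^sub>T (\<lambda>_. False)) (table_index p q (prod_encode (t, i)))"
  shows "a \<le>\<^sub>h y"
  unfolding hyp_le_def
proof (intro exI conjI bexI)
  let ?R = "{(0::nat, 0::nat)}" and ?J = "\<lambda>_::nat. turing_jump (y \<oplus>\<^sub>T (\<lambda>_. False))"
  show "Well_order ?R"
    by (simp add: well_order_on_def linear_order_on_def partial_order_on_def preorder_on_def
        refl_on_def trans_def antisym_def total_on_def wf_def Field_def)
  show "(\<lambda>k. prod_decode k \<in> ?R) \<le>\<^sub>T y"
    unfolding turing_le_def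
  proof (intro exI allI)
    fix k
    have "prod_decode k = (0, 0) \<longleftrightarrow> k = prod_encode (0, 0)"
      by (metis prod_decode_inverse prod_encode_inverse)
    hence "prod_decode k \<in> ?R \<longleftrightarrow> k = 0" by (simp add: prod_encode_def)
    moreover have "computes_to y (recp (cstp 1) Zero) k (of_bool (k = 0))"
      by (rule computes_recp) (auto intro: computes_cstp computes_intros(1) simp: computes_cstp[of _ 1, simplified])
    ultimately show "computes_to y (recp (cstp 1) Zero) k (of_bool (prod_decode k \<in> ?R))" by simp
  qed
  have "hier_below ?R ?J 0 = (\<lambda>_. False)" by (auto simp: hier_below_def fun_eq_iff split: prod.splits)
  thus "jump_hierarchy y ?R ?J" by (simp add: jump_hierarchy_iff)
  show "a \<le>\<^sub>T ?J 0" by (rule turing_le_table) (rule assms)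
  show "0 \<in> Field ?R" by (simp add: Field_def)
qed

text \<open>The jump is iterated along the order coded in \<open>y\<close> itself. Row
  \<open>n\<close> of the forcing relation negates an existential statement over the rows below, so
  one jump per node is enough; the top stage 0 sees all rows, and its jump yields both
  \<open>H\<close> and the decoded real.\<close>

lemma hyperarithmetic_decoding:
  obtains c where
    "\<And>y. wo_top (wpart y) \<Longrightarrow> \<exists>H. forcing (wpart y) H \<and> H \<le>\<^sub>h y \<oplus>\<^sub>T c \<and>
       decode (wpart y) H (upart y) \<le>\<^sub>h y \<oplus>\<^sub>T c"
    "\<And>y. wpart (upart y) \<le>\<^sub>h y \<oplus>\<^sub>T c" "\<And>y. upart (upart y) \<le>\<^sub>h y \<oplus>\<^sub>T c"
proof -
  obtain c where c: "\<And>y Z t i. (t = 1 \<Longrightarrow> dense_family (decides (wpart y) (stage_forcing Z))) \<Longrightarrow>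
    turing_jump ((y \<oplus>\<^sub>T c) \<oplus>\<^sub>T Z) (oidx t i) \<longleftrightarrow> stage_pred (prod_encode (t, i)) y Z"
    using stage_oracle by blast
  have "wpart (upart y) \<le>\<^sub>h y \<oplus>\<^sub>T c" for y
    by (rule hyp_le_singleton[of _ _ 4 2 2])
      (use c[of 2 y] in \<open>simp add: oidx_def stage_pred_def wpart_def\<close>)
  moreover have "upart (upart y) \<le>\<^sub>h y \<oplus>\<^sub>T c" for y
    by (rule hyp_le_singleton[of _ _ 4 2 3])
      (use c[of 3 y] in \<open>simp add: oidx_def stage_pred_def upart_def\<close>)
  moreover have "\<exists>H. forcing (wpart y) H \<and> H \<le>\<^sub>h y \<oplus>\<^sub>T c \<and> decode (wpart y) H (upart y) \<le>\<^sub>h y \<oplus>\<^sub>T c"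
    if wo: "wo_top (wpart y)" for y
  proof -
    define w where "w = wpart y"
    have lin: "lin_top w" using wo by (simp add: w_def wo_top_def)
    obtain J where J: "jump_hierarchy (y \<oplus>\<^sub>T c) (wrel w) J"
      using ex_jump_hierarchy[OF wf_wrel[OF wo]] unfolding w_def by blast
    define Z where "Z = hier_below (wrel w) J"
    have J': "J n = turing_jump ((y \<oplus>\<^sub>T c) \<oplus>\<^sub>T Z n)" for n
      using J by (simp add: jump_hierarchy_iff Z_def Field_wrel[OF lin])
    have Z: "Z n (prod_encode (m, i)) \<longleftrightarrow> wR w m n \<and> m \<noteq> n \<and> J m i" for n m i
      by (simp add: Z_def hier_below_simp wrel_def)
    define H where "H = stage_forcing (Z 0)"
    have top: "wR w m 0" and nonzero: "wR w m n \<Longrightarrow> m \<noteq> n \<Longrightarrow> m \<noteq> 0" for m n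
      using lin unfolding lin_top_def by metis+
    have H: "H (prod_encode (n, s)) \<longleftrightarrow> n \<noteq> 0 \<and> \<not> J n (oidx (n + 4) s)" for n s
      by (auto simp: H_def stage_forcing_def Z top)
    have kid: "kid_forced w (stage_forcing (Z n)) n m t \<longleftrightarrow> kid_forced w H n m t" for n m t
    proof -
      have "stage_forcing (Z n) (prod_encode (m, s)) = H (prod_encode (m, s))" if "wR w m n" "m \<noteq> n" for s
        using that nonzero[OF that] by (simp add: stage_forcing_def Z H)
      thus ?thesis unfolding kid_forced_def forced_def by blast
    qed
    have forcing: "forcing w H"
      unfolding forcing_def H J' by (subst c) (auto simp: stage_pred_def kid simp flip: w_def)
    note D = dense_decides[OF forcing]
    have rel: "(\<lambda>k. prod_decode k \<in> wrel w) \<le>\<^sub>T y \<oplus>\<^sub>T c"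
    proof (rule turing_le_query)
      fix k
      \<comment> \<open>The factor 8 comes from three nested joins: the order lies on the even
        positions of \<open>w\<close>, \<open>w\<close> on those of \<open>y\<close>, and
        \<open>y\<close> on those of the oracle.\<close>
      show "computes_to (y \<oplus>\<^sub>T c) (linp 8 0) k (8 * k + 0)" by (rule computes_linp)
      have "(y \<oplus>\<^sub>T c) (8 * k + 0) = w (2 * k)"
        using join_even[of y c "4 * k"] by (simp add: w_def wpart_def)
      thus "(prod_decode k \<in> wrel w) = (y \<oplus>\<^sub>T c) (8 * k + 0)"
        by (auto simp: wrel_def wR_def split: prod.splits)
    qed
    have hyp: "a \<le>\<^sub>h y \<oplus>\<^sub>T c" if "\<And>i. a i = J 0 (oidx t i)" for a t
      unfolding hyp_le_def
    proof (intro exI conjI bexI)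
      show "Well_order (wrel w)" using Well_order_wrel wo by (simp add: w_def)
      show "a \<le>\<^sub>T J 0" by (rule turing_le_table) (use that in \<open>simp add: oidx_def\<close>)
      show "0 \<in> Field (wrel w)" using Field_wrel[OF lin] by simp
    qed (fact rel J)+
    have "H \<le>\<^sub>h y \<oplus>\<^sub>T c"
    proof (rule hyp)
      show "H i = J 0 (oidx 0 i)" for i
        using c[of 0 y "Z 0" i] unfolding J'[of 0] by (simp add: stage_pred_def H_def)
    qed
    moreover have "decode w H (upart y) \<le>\<^sub>h y \<oplus>\<^sub>T c"
    proof (rule hyp)
      show "decode w H (upart y) i = J 0 (oidx 1 i)" for i
        using c[of 1 y "Z 0" i] D unfolding J'[of 0] by (simp add: stage_pred_def H_def w_def)
    qed
    ultimately show ?thesis using forcing by (auto simp: w_def)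
  qed
  ultimately show ?thesis using that by blast
qed

lemma ex_forcing:
  assumes "wo_top w"
  shows "\<exists>H. forcing w H"
proof (rule hyperarithmetic_decoding)
  fix c
  assume "\<And>y. wo_top (wpart y) \<Longrightarrow> \<exists>H. forcing (wpart y) H \<and> H \<le>\<^sub>h y \<oplus>\<^sub>T c \<and>
       decode (wpart y) H (upart y) \<le>\<^sub>h y \<oplus>\<^sub>T c"
  from this[of "w \<oplus>\<^sub>T w"] assms show ?thesis by auto
qed

text \<open>A difference code is existential over the two sequences, so a single jump decodes it. As
  the join associates to the right, the stage oracle holds \<open>x\<close> at \<open>4 k\<close>,
  \<open>y\<close> at \<open>8 k + 2\<close> and the table at \<open>8 k + 6\<close>.\<close>

lemma hyperarithmetic_pair_decoding:
  obtains c where "\<And>x y. diff_code 0 (upart x) (upart y) \<le>\<^sub>h x \<oplus>\<^sub>T y \<oplus>\<^sub>T c"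
    "\<And>x y. upart y \<le>\<^sub>h x \<oplus>\<^sub>T y \<oplus>\<^sub>T c"
proof -
  define xof yof where "xof = (\<lambda>X :: nat \<Rightarrow> bool. \<lambda>k. X (4 * k))"
    and "yof = (\<lambda>X :: nat \<Rightarrow> bool. \<lambda>k. X (8 * k + 2))"
  define V where "V = (\<lambda>j. {X. case prod_decode j of (t, i) \<Rightarrow>
    if t = 0 then diff_code 0 (upart (xof X)) (upart (yof X)) i else upart (yof X) i})"
  have "open (V j)" for j
  proof -
    obtain t i where j: "prod_decode j = (t, i)" by fastforce
    have "open {X :: nat \<Rightarrow> bool. X k \<noteq> X l}" "open {X :: nat \<Rightarrow> bool. X k}" for k l
      unfolding open_cantor_iff
      by (intro ballI exI[of _ "Suc (max k l)"], simp)
        (intro ballI exI[of _ "Suc k"], simp)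
    hence "open (\<Union>q. {X :: nat \<Rightarrow> bool. X (4 * (2 * (2 * prod_encode (i, q)) + 1)) \<noteq>
        X (8 * (2 * (2 * prod_encode (i, q)) + 1) + 2)})" "open {X. X (8 * (2 * i + 1) + 2)}"
      by blast+
    moreover have "V j = (if t = 0 then (\<Union>q. {X :: nat \<Rightarrow> bool. X (4 * (2 * (2 * prod_encode (i, q)) + 1)) \<noteq>
        X (8 * (2 * (2 * prod_encode (i, q)) + 1) + 2)}) else {X. X (8 * (2 * i + 1) + 2)})"
      by (auto simp: V_def j diff_code_def upart_def xof_def yof_def)
    ultimately show ?thesis by simp
  qed
  from jump_table[of V 8 6, OF this] obtain c where c: "\<And>X j. (\<And>k. X (8 * k + 6) = c k) \<Longrightarrow>
      turing_jump X (table_index 8 6 j) \<longleftrightarrow> X \<in> V j" by blast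
  have "turing_jump ((x \<oplus>\<^sub>T y \<oplus>\<^sub>T c) \<oplus>\<^sub>T (\<lambda>_. False)) (table_index 8 6 (prod_encode (t, i))) \<longleftrightarrow>
    (if t = 0 then diff_code 0 (upart x) (upart y) i else upart y i)" for x y t i
  proof -
    define X where "X = (x \<oplus>\<^sub>T y \<oplus>\<^sub>T c) \<oplus>\<^sub>T (\<lambda>_. False)"
    have X: "X (4 * k) = x k" "X (8 * k + 2) = y k" "X (8 * k + 6) = c k" for k
    proof -
      have "X (2 * j) = (x \<oplus>\<^sub>T y \<oplus>\<^sub>T c) j" for j unfolding X_def by (rule join_even)
      from this[of "2 * k"] this[of "2 * (2 * k) + 1"] this[of "2 * (2 * k + 1) + 1"]
      show "X (4 * k) = x k" "X (8 * k + 2) = y k" "X (8 * k + 6) = c k"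
        unfolding join_even join_odd by (simp_all add: algebra_simps eval_nat_numeral)
    qed
    thus ?thesis using c[OF X(3), of "prod_encode (t, i)"] by (simp add: V_def xof_def yof_def X_def)
  qed
  hence "diff_code 0 (upart x) (upart y) \<le>\<^sub>h x \<oplus>\<^sub>T y \<oplus>\<^sub>T c" "upart y \<le>\<^sub>h x \<oplus>\<^sub>T y \<oplus>\<^sub>T c" for x y
    by (intro hyp_le_singleton[of _ _ 8 6 0] hyp_le_singleton[of _ _ 8 6 1]; simp)+
  thus ?thesis using that by blast
qed

subsection \<open>Every Borel set is denoted by a node\<close>

definition mk_code :: "(nat \<Rightarrow> nat \<Rightarrow> bool) \<Rightarrow> (nat \<Rightarrow> nat \<Rightarrow> bool) \<Rightarrow> (nat \<Rightarrow> nat \<Rightarrow> bool) \<Rightarrow> nat \<Rightarrow> bool" where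
  "mk_code R K L = (\<lambda>k. if even k then case_prod R (prod_decode (k div 2))
    else if k mod 4 = 1 then case_prod K (prod_decode (k div 4))
    else case_prod L (prod_decode (k div 4)))"

lemma wR_mk_code: "wR (mk_code R K L) = R" 
  by (simp add: fun_eq_iff wR_def mk_code_def)

lemma wK_mk_code: "wK (mk_code R K L) = K"
proof -
  have "odd (4 * k + 1)" "(4 * k + 1) mod 4 = 1" "(4 * k + 1) div 4 = k" for k :: nat by presburger+
  thus ?thesis by (simp only: fun_eq_iff wK_def mk_code_def if_True if_False not_not prod_encode_inverse) simp
qed

lemma wL_mk_code: "wL (mk_code R K L) = L"
proof -
  have "odd (4 * k + 3)" "(4 * k + 3) mod 4 \<noteq> 1" "(4 * k + 3) div 4 = k" for k :: nat by presburger+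
  thus ?thesis by (simp only: fun_eq_iff wL_def mk_code_def if_True if_False not_not prod_encode_inverse) simp
qed

definition node_coded :: "(nat \<Rightarrow> bool) set \<Rightarrow> bool" where
  "node_coded A \<longleftrightarrow> (\<exists>w B. wo_top w \<and> node_sets w B \<and> A = B 0)"

lemma node_coded_Compl_literal: "node_coded {x. \<not> x j}"
proof -
  \<comment> \<open>Order type \<omega> + 1: the positive numbers in their usual order, with 0 on
    top.\<close>
  define R where "R = (\<lambda>m n :: nat. n = 0 \<or> (m \<noteq> 0 \<and> m \<le> n))"
  define w where "w = mk_code R (\<lambda>_ _. False) (\<lambda>n i. n = 0 \<and> i = j)"
  have w: "wR w = R" "wK w = (\<lambda>_ _. False)" "wL w = (\<lambda>n i. n = 0 \<and> i = j)"
    by (simp_all add: w_def wR_mk_code wK_mk_code wL_mk_code)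
  have "lin_top w"
    unfolding lin_top_def w R_def by (intro conjI allI) auto
  moreover have "\<not> no_min w z" for z
  proof
    assume z: "no_min w z"
    show False
    proof (cases "\<exists>n. z n \<and> n \<noteq> 0")
      case True
      define n where "n = (LEAST n. z n \<and> n \<noteq> 0)"
      have "z n \<and> n \<noteq> 0" unfolding n_def using True by (rule LeastI_ex)
      moreover from this obtain m where "z m" "R m n" "m \<noteq> n" using z unfolding no_min_def w by blast
      ultimately have "z m \<and> m \<noteq> 0" "m < n" unfolding R_def by auto
      thus False using not_less_Least[of m "\<lambda>n. z n \<and> n \<noteq> 0"] unfolding n_def by blast
    next
      case False
      thus False using z unfolding no_min_def by metis
    qed
  qed
  moreover have "node_sets w (\<lambda>n. {x. n = 0 \<longrightarrow> \<not> x j})"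
    unfolding node_sets_def w by auto
  ultimately show ?thesis
    unfolding node_coded_def wo_top_def
    by (intro exI[of _ w] exI[of _ "\<lambda>n. {x. n = 0 \<longrightarrow> \<not> x j}"]) auto
qed

text \<open>The given orders are placed one after another, and a new top 0 gets the old tops as
  children. This serves both the closure properties of \<open>node_coded\<close> and the packing of
  a whole family of sets into one \<open>w\<close>; the node numbers are those used by
  \<open>target\<close>.\<close>

lemma merge_codes:
  assumes "\<And>i::nat. node_coded (A i)"
  obtains w B where "wo_top w" "node_sets w B" "B 0 = - (\<Union>i. A i)"
    "\<And>i. B (Suc (prod_encode (i, 0))) = A i"
proof -
  from assms have "\<forall>i. \<exists>w B. wo_top w \<and> node_sets w B \<and> A i = B 0" by (simp add: node_coded_def)
  then obtain W C where W: "\<And>i. wo_top (W i)" "\<And>i. node_sets (W i) (C i)" "\<And>i. A i = C i 0"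
    by metis
  define nd where "nd = (\<lambda>i n. Suc (prod_encode (i, n)))"
  have nd_cases: "n = 0 \<or> (\<exists>i m. n = nd i m)" for n
    unfolding nd_def by (cases n) (auto, metis prod_decode_inverse surj_pair)
  have nd_simps: "nd i m \<noteq> 0" "0 \<noteq> nd i m" "nd i m = nd j n \<longleftrightarrow> i = j \<and> m = n" for i m j n
    by (auto simp: nd_def)
  define R where "R = (\<lambda>m n. n = 0 \<or> (\<exists>i m' j n'. m = nd i m' \<and> n = nd j n' \<and>
    (i < j \<or> i = j \<and> wR (W i) m' n')))"
  define K where "K = (\<lambda>n m. (n = 0 \<and> (\<exists>i. m = nd i 0)) \<or>
    (\<exists>i n' m'. n = nd i n' \<and> m = nd i m' \<and> wK (W i) n' m'))"
  define L where "L = (\<lambda>n l. \<exists>i n'. n = nd i n' \<and> wL (W i) n' l)"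
  define B where "B = (\<lambda>n. if n = 0 then - (\<Union>i. A i) else case prod_decode (n - 1) of (i, n') \<Rightarrow> C i n')"
  define w where "w = mk_code R K L"
  have w: "wR w = R" "wK w = K" "wL w = L"
    by (simp_all add: w_def wR_mk_code wK_mk_code wL_mk_code)
  have R: "R m 0" "\<not> R 0 (nd j n)" "R (nd i m) (nd j n) \<longleftrightarrow> i < j \<or> i = j \<and> wR (W i) m n" for i m j n
    by (auto simp: R_def nd_simps)
  have K: "K 0 m \<longleftrightarrow> (\<exists>i. m = nd i 0)" "K (nd i n) m \<longleftrightarrow> (\<exists>m'. m = nd i m' \<and> wK (W i) n m')" for i m n
    by (auto simp: K_def nd_simps)
  have L: "\<not> L 0 l" "L (nd i n) l \<longleftrightarrow> wL (W i) n l" for i n l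
    by (auto simp: L_def nd_simps)
  have B: "B 0 = - (\<Union>i. A i)" "B (nd i n) = C i n" for i n
    by (simp_all add: B_def nd_def)
  have W_lin: "wR (W i) m m" "wR (W i) m n \<Longrightarrow> wR (W i) n m \<Longrightarrow> m = n"
    "wR (W i) l m \<Longrightarrow> wR (W i) m n \<Longrightarrow> wR (W i) l n" "wR (W i) m n \<or> wR (W i) n m" for i l m n
    using W(1)[of i] unfolding wo_top_def lin_top_def by metis+
  have "lin_top w"
    unfolding lin_top_def w
  proof (intro conjI allI impI; (elim conjE)?)
    show "R m m" for m using nd_cases[of m] R W_lin(1) by auto
    show "R m 0" for m by (rule R)
    show "R m n \<or> R n m" for m n
    proof (cases "m = 0 \<or> n = 0")
      case False
      then obtain i m' j n' where mn: "m = nd i m'" "n = nd j n'" using nd_cases by metis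
      show ?thesis using W_lin(4)[of j m' n'] linorder_less_linear[of i j] unfolding mn R(3) by blast
    qed (auto simp: R)
    show "m = n" if "R m n" "R n m" for m n
      using nd_cases[of m] nd_cases[of n] that W_lin(2) by (auto simp: R nd_simps)
    show "R l n" if "R l m" "R m n" for l m n
    proof (cases "n = 0")
      case False
      then obtain k n' where n: "n = nd k n'" using nd_cases[of n] by blast
      have "m \<noteq> 0" using that(2) R(2)[of k n'] unfolding n by metis
      then obtain j m' where m: "m = nd j m'" using nd_cases[of m] by blast
      have "l \<noteq> 0" using that(1) R(2)[of j m'] unfolding m by metis
      then obtain i l' where l: "l = nd i l'" using nd_cases[of l] by blast
      from that have "i < j \<or> i = j \<and> wR (W i) l' m'" "j < k \<or> j = k \<and> wR (W j) m' n'"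
        unfolding n m l R(3) .
      thus ?thesis unfolding n l R(3) using W_lin(3)[of i l' m' n'] less_trans[of i j k] by blast
    qed (simp add: R)
  qed
  moreover have "\<not> no_min w z" for z
  proof
    assume z: "no_min w z"
    have "\<exists>n. z n \<and> n \<noteq> 0" using z unfolding no_min_def by metis
    hence ex: "\<exists>i. \<exists>m. z (nd i m)" using nd_cases by metis
    define i where "i = (LEAST i. \<exists>m. z (nd i m))"
    have "\<exists>m. z (nd i m)" unfolding i_def using ex by (rule LeastI_ex)
    moreover have "\<not> no_min (W i) (\<lambda>m. z (nd i m))" using W(1) by (simp add: wo_top_def)
    ultimately obtain m where m: "z (nd i m)" "\<And>m'. z (nd i m') \<Longrightarrow> wR (W i) m' m \<Longrightarrow> m' = m"
      unfolding no_min_def by blast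
    obtain n where n: "z n" "R n (nd i m)" "n \<noteq> nd i m"
      using z m(1) unfolding no_min_def w by blast
    hence "n \<noteq> 0" using R(2)[of i m] by metis
    then obtain j m' where jm: "n = nd j m'" using nd_cases[of n] by blast
    have "\<not> j < i" using not_less_Least[of j "\<lambda>i. \<exists>m. z (nd i m)"] n(1) unfolding i_def jm by blast
    thus False using n m(2)[of m'] unfolding jm R(3) nd_simps by blast
  qed
  moreover have "node_sets w B"
    unfolding node_sets_def w
  proof
    fix n
    show "B n = {x. \<not> (\<exists>m. K n m \<and> R m n \<and> m \<noteq> n \<and> x \<in> B m) \<and> \<not> (\<exists>l. L n l \<and> x l)}"
    proof (cases "n = 0")
      case True
      thus ?thesis by (auto simp: K R L B nd_simps W(3))
    next
      case False
      then obtain i n' where n: "n = nd i n'" using nd_cases[of n] by blast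
      have "C i n' = {x. \<not> (\<exists>m. wK (W i) n' m \<and> wR (W i) m n' \<and> m \<noteq> n' \<and> x \<in> C i m) \<and>
          \<not> (\<exists>l. wL (W i) n' l \<and> x l)}"
        using W(2)[of i] unfolding node_sets_def by blast
      moreover have "(\<exists>m. K (nd i n') m \<and> R m (nd i n') \<and> m \<noteq> nd i n' \<and> x \<in> B m) \<longleftrightarrow>
          (\<exists>m. wK (W i) n' m \<and> wR (W i) m n' \<and> m \<noteq> n' \<and> x \<in> C i m)" (is "?l \<longleftrightarrow> ?r") for x
      proof -
        have "?l \<longleftrightarrow> (\<exists>m. wK (W i) n' m \<and> R (nd i m) (nd i n') \<and> nd i m \<noteq> nd i n' \<and> x \<in> B (nd i m))"
          unfolding K(2) by blast
        thus ?thesis by (simp add: R B nd_simps)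
      qed
      ultimately show ?thesis unfolding n B(2) L(2) by simp
    qed
  qed
  moreover have "B (Suc (prod_encode (i, 0))) = A i" for i
    using B(2)[of i 0] by (simp add: nd_def W(3))
  ultimately show ?thesis using that[of w B] B(1) unfolding wo_top_def by blast
qed

lemma node_coded_Compl_UN: "(\<And>i::nat. node_coded (A i)) \<Longrightarrow> node_coded (- (\<Union>i. A i))"
  by (rule merge_codes[of A]) (blast, metis node_coded_def)

lemma node_coded_Compl: "node_coded A \<Longrightarrow> node_coded (- A)"
  using node_coded_Compl_UN[of "\<lambda>_. A"] by simp

lemma node_coded_UN: "(\<And>i::nat. node_coded (A i)) \<Longrightarrow> node_coded (\<Union>i. A i)"
  using node_coded_Compl[OF node_coded_Compl_UN[of A]] by simp

lemma node_coded_Int: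
  assumes "node_coded A" "node_coded B"
  shows "node_coded (A \<inter> B)"
proof -
  have "node_coded (- (\<Union>i::nat. if i = 0 then - A else - B))"
    using assms by (intro node_coded_Compl_UN) (auto intro: node_coded_Compl)
  also have "- (\<Union>i::nat. if i = 0 then - A else - B) = A \<inter> B"
    by (auto split: if_splits)
  finally show ?thesis .
qed

lemma node_coded_literal: "node_coded {x. x j = b}"
  using node_coded_Compl_literal[of j] node_coded_Compl[OF node_coded_Compl_literal[of j]]
  by (cases b) (simp_all add: Compl_eq)

lemma node_coded_UNIV: "node_coded UNIV" and node_coded_empty: "node_coded {}"
proof -
  show *: "node_coded {}"
    using node_coded_Int[OF node_coded_literal[of 0 True] node_coded_literal[of 0 False]]
    by (auto simp: Int_def)
  show "node_coded UNIV" using node_coded_Compl[OF *] by simp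
qed

lemma node_coded_cylinder: "node_coded {x. \<forall>i<n. x i = y i}"
proof (induction n)
  case 0
  show ?case by (simp add: node_coded_UNIV)
next
  case (Suc n)
  have "{x. \<forall>i<Suc n. x i = y i} = {x. \<forall>i<n. x i = y i} \<inter> {x. x n = y n}"
    by (auto simp: less_Suc_eq)
  thus ?case using node_coded_Int[OF Suc node_coded_literal] by simp
qed

lemma node_coded_open:
  assumes "open V"
  shows "node_coded V"
proof -
  define cyl where "cyl = (\<lambda>s :: bool list. {x :: nat \<Rightarrow> bool. \<forall>i<length s. x i = s ! i})"
  define A where "A = (\<lambda>k. if cyl (from_nat k) \<subseteq> V then cyl (from_nat k) else {})"
  have "node_coded (\<Union>k. A k)"
    by (rule node_coded_UN) (simp add: A_def cyl_def node_coded_cylinder node_coded_empty)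
  also have "(\<Union>k. A k) = V"
  proof (intro equalityI subsetI)
    fix x assume x: "x \<in> V"
    then obtain k where k: "\<And>y. \<forall>i<k. y i = x i \<Longrightarrow> y \<in> V"
      using assms unfolding open_cantor_iff by blast
    define s where "s = map x [0..<k]"
    have "x \<in> cyl s" "cyl s \<subseteq> V" using k by (auto simp: cyl_def s_def)
    hence "x \<in> A (to_nat s)" by (simp add: A_def)
    thus "x \<in> (\<Union>k. A k)" by blast
  qed (auto simp: A_def split: if_splits)
  finally show ?thesis .
qed

lemma node_coded_borel:
  assumes "A \<in> sets borel"
  shows "node_coded A"
proof -
  have "A \<in> sigma_sets UNIV {S. open S}" using assms by (simp add: borel_def)
  thus ?thesis
  proof induction
    case (Compl a)
    thus ?case using node_coded_Compl[of a] by (simp add: Compl_eq_Diff_UNIV)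
  qed (auto intro: node_coded_open node_coded_empty node_coded_UN)
qed

lemma borel_function_not_coding:
  assumes f: "f \<in> borel \<rightarrow>\<^sub>M borel"
  shows "\<exists>w a. wo_top w \<and> (\<forall>H u. forcing w H \<longrightarrow> generic (decides w H) u \<longrightarrow> \<not> a \<le>\<^sub>T f (w \<oplus>\<^sub>T u))"
proof -
  \<comment> \<open>\<open>inv goedel_number\<close> is arbitrary off the range; below it is
    evaluated at indices \<open>goedel_number p\<close> only.\<close>
  define prog where "prog = (\<lambda>n. inv goedel_number (fst (prod_decode n)))"
  define A where "A = (\<lambda>n. {x. computes_to (f x) (prog n) n 1})"
  have "A n \<in> sets borel" for n
  proof -
    have "{Y. computes_to Y (prog n) n 1} \<in> sets borel" by (simp add: open_computes_to)
    from measurable_sets[OF f this] show ?thesis by (simp add: A_def vimage_def)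
  qed
  from merge_codes[of A, OF node_coded_borel[OF this]] obtain w B where w: "wo_top w" "node_sets w B"
      and B: "\<And>n. B (Suc (prod_encode (n, 0))) = A n"
    by metis
  obtain H where H: "forcing w H" using ex_forcing[OF w(1)] by blast
  define a where "a = (\<lambda>n. \<not> forced H (Suc (prod_encode (n, 0))) (from_nat (snd (prod_decode n))))"
  have "\<not> a \<le>\<^sub>T f (w \<oplus>\<^sub>T u)" if "forcing w H'" and u: "generic (decides w H') u" for H' u
  proof
    assume "a \<le>\<^sub>T f (w \<oplus>\<^sub>T u)"
    then obtain p where p: "\<And>n. computes_to (f (w \<oplus>\<^sub>T u)) p n (of_bool (a n))"
      unfolding turing_le_def by blast
    have "H' = H" using forcing_unique[OF w(1) that(1) H] .
    from diagonal[OF w H u[unfolded this], of a "goedel_number p"]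
    obtain s where s: "(w \<oplus>\<^sub>T u \<in> A (prod_encode (goedel_number p, s))) \<noteq> a (prod_encode (goedel_number p, s))"
      unfolding B by (auto simp: a_def)
    have "prog (prod_encode (goedel_number p, s)) = p"
      unfolding prog_def by (simp add: inv_f_f inj_def goedel_number_inject)
    hence "w \<oplus>\<^sub>T u \<in> A (prod_encode (goedel_number p, s)) \<longleftrightarrow>
        computes_to (f (w \<oplus>\<^sub>T u)) p (prod_encode (goedel_number p, s)) 1"
      by (simp add: A_def)
    thus False using s p[of "prod_encode (goedel_number p, s)"] computes_to_deterministic
      by (metis of_bool_eq(1) of_bool_eq(2) zero_neq_one)
  qed
  thus ?thesis using w(1) by blast
qed

subsection \<open>The equivalence relation\<close>

definition bad_witness :: "(nat \<Rightarrow> bool) \<Rightarrow> (nat \<Rightarrow> bool) \<Rightarrow> bool" where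
  "bad_witness x z \<longleftrightarrow> \<not> lin_top (wpart x) \<or> no_min (wpart x) z \<or>
     forcing (wpart x) z \<and> \<not> generic (decides (wpart x) z) (upart x)"

definition good_witness :: "(nat \<Rightarrow> bool) \<Rightarrow> (nat \<Rightarrow> bool) \<Rightarrow> (nat \<Rightarrow> bool) \<Rightarrow> bool" where
  "good_witness x y z \<longleftrightarrow> wpart x = wpart y \<and> forcing (wpart x) z \<and>
     generic (decides (wpart x) z) (upart x) \<and> generic (decides (wpart x) z) (upart y)"

definition bad :: "(nat \<Rightarrow> bool) \<Rightarrow> bool" where "bad x \<longleftrightarrow> (\<exists>z. bad_witness x z)"

definition class_rel :: "(nat \<Rightarrow> bool) rel" where
  "class_rel = {(x, y). bad x \<and> bad y \<or> \<not> bad x \<and> \<not> bad y \<and> wpart x = wpart y}"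

text \<open>Equality is included because every \<open>z\<close> must witness \<open>(x, x)\<close>.
  The two bad cases exchange the halves of \<open>z\<close>, as symmetry in \<open>x\<close> and
  \<open>y\<close> requires.\<close>

definition class_unfolding :: "((nat \<Rightarrow> bool) \<times> (nat \<Rightarrow> bool) \<times> (nat \<Rightarrow> bool)) set" where
  "class_unfolding = {(x, y, z). x = y \<or> good_witness x y z \<or>
     bad_witness x (wpart z) \<and> bad_witness y (upart z) \<or>
     bad_witness x (upart z) \<and> bad_witness y (wpart z)}"

lemma good_witness_commute: "good_witness x y z \<longleftrightarrow> good_witness y x z"
  by (auto simp: good_witness_def)

lemma not_bad_iff:
  assumes "forcing (wpart x) H"
  shows "\<not> bad x \<longleftrightarrow> wo_top (wpart x) \<and> generic (decides (wpart x) H) (upart x)"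
  using assms forcing_unique[of "wpart x" H] unfolding bad_def bad_witness_def wo_top_def by metis

lemma not_bad_ex:
  assumes "\<not> bad x"
  shows "wo_top (wpart x)" "\<exists>H. forcing (wpart x) H \<and> generic (decides (wpart x) H) (upart x)"
proof -
  show wo: "wo_top (wpart x)"
    using assms unfolding bad_def bad_witness_def wo_top_def by blast
  obtain H where "forcing (wpart x) H" using ex_forcing[OF wo] by blast
  thus "\<exists>H. forcing (wpart x) H \<and> generic (decides (wpart x) H) (upart x)"
    using not_bad_iff assms by blast
qed

lemma equiv_class_rel: "equiv UNIV class_rel"
  unfolding equiv_def refl_on_def sym_def trans_def class_rel_def by auto

text \<open>Over a well-order \<open>z\<close> is the only forcing relation and both points are
  good. Over any other common \<open>w\<close> both are bad, hence equivalent as well.\<close>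

lemma good_witness_class_rel: "good_witness x y z \<Longrightarrow> (x, y) \<in> class_rel"
  using not_bad_iff[of x z] not_bad_iff[of y z] by (auto simp: good_witness_def class_rel_def)

lemma bad_witness_class_rel: "bad_witness x z \<Longrightarrow> bad_witness y z' \<Longrightarrow> (x, y) \<in> class_rel"
  by (auto simp: class_rel_def bad_def)

lemma class_rel_iff: "(x, y) \<in> class_rel \<longleftrightarrow> (\<exists>z. (x, y, z) \<in> class_unfolding)"
proof
  assume "(x, y) \<in> class_rel"
  then consider "bad x" "bad y" | "\<not> bad x" "\<not> bad y" "wpart x = wpart y"
    by (auto simp: class_rel_def)
  thus "\<exists>z. (x, y, z) \<in> class_unfolding"
  proof cases
    case 1
    then obtain z z' where "bad_witness x z" "bad_witness y z'" by (auto simp: bad_def)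
    thus ?thesis by (intro exI[of _ "z \<oplus>\<^sub>T z'"]) (simp add: class_unfolding_def)
  next
    case 2
    obtain H where "forcing (wpart x) H" using not_bad_ex[OF 2(1)] by blast
    hence "good_witness x y H" using 2 not_bad_iff[of x H] not_bad_iff[of y H] by (simp add: good_witness_def)
    thus ?thesis by (auto simp: class_unfolding_def)
  qed
next
  assume "\<exists>z. (x, y, z) \<in> class_unfolding"
  thus "(x, y) \<in> class_rel"
    using good_witness_class_rel bad_witness_class_rel equiv_class_rel
    by (auto simp: class_unfolding_def equiv_def refl_on_def)
qed

text \<open>The empty relation is not reflexive, so every real witnesses badness here. The second
  half of such a point is free to store data within the bad class.\<close>

lemma bad_if_blank: "wpart x = (\<lambda>_. False) \<Longrightarrow> bad_witness x z"
  by (simp add: bad_witness_def lin_top_def wR_def)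

lemma lin_top_not_blank: "lin_top w \<Longrightarrow> w \<noteq> (\<lambda>_. False)"
  by (auto simp: lin_top_def wR_def)

subsection \<open>Measurability\<close>

lemma pred_bit_continuous:
  fixes g :: "'a::topological_space \<Rightarrow> nat \<Rightarrow> bool"
  assumes "continuous_on UNIV g"
  shows "Measurable.pred borel (\<lambda>x. g x i)"
proof -
  have "continuous_on UNIV (\<lambda>x. g x i)"
    using assms by (rule continuous_on_product_then_coordinatewise)
  hence "open ((\<lambda>x. g x i) -` {True})"
    by (intro open_vimage) (simp_all add: open_discrete)
  thus ?thesis by (simp add: pred_def vimage_def)
qed

lemma borel_measurable_pred:
  assumes "Measurable.pred M P"
  shows "P \<in> borel_measurable M"
  using assms by (rule measurable_compose) (simp add: measurable_count_space_eq1)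

context
  fixes M :: "'a measure" and x y z :: "'a \<Rightarrow> nat \<Rightarrow> bool"
  assumes x [measurable]: "\<And>i. Measurable.pred M (\<lambda>p. x p i)"
    and y [measurable]: "\<And>i. Measurable.pred M (\<lambda>p. y p i)"
    and z [measurable]: "\<And>i. Measurable.pred M (\<lambda>p. z p i)"
begin

lemma pred_eq_bits: "Measurable.pred M (\<lambda>p. x p = y p)"
  unfolding fun_eq_iff by measurable

lemma pred_parts: "Measurable.pred M (\<lambda>p. wpart (x p) i)" "Measurable.pred M (\<lambda>p. upart (x p) i)"
  unfolding wpart_def upart_def by measurable

lemma pred_diff_code: "Measurable.pred M (\<lambda>p. diff_code b (x p) (y p) i)"
  unfolding diff_code_def by measurable

lemma pred_lin_top: "Measurable.pred M (\<lambda>p. lin_top (x p))"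
  unfolding lin_top_def wR_def by measurable

lemma pred_no_min: "Measurable.pred M (\<lambda>p. no_min (x p) (y p))"
  unfolding no_min_def wR_def by measurable

text \<open>With \<open>H\<close> as an argument, only quantifiers over numbers and finite strings
  remain.\<close>

lemma pred_forcing: "Measurable.pred M (\<lambda>p. forcing (x p) (y p))"
  unfolding forcing_def kid_forced_def forced_def wleaf_def wR_def wK_def wL_def by measurable

lemma pred_generic: "Measurable.pred M (\<lambda>p. generic (decides (x p) (y p)) (z p))"
  unfolding generic_on_def decides_def kid_forced_def forced_def wleaf_def wR_def wK_def wL_def
  by measurable

end

lemma pred_witness:
  assumes x: "\<And>i. Measurable.pred M (\<lambda>p. x p i)" and y: "\<And>i. Measurable.pred M (\<lambda>p. y p i)"
    and z: "\<And>i. Measurable.pred M (\<lambda>p. z p i)"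
  shows "Measurable.pred M (\<lambda>p. bad_witness (x p) (z p))"
    and "Measurable.pred M (\<lambda>p. good_witness (x p) (y p) (z p))"
proof -
  note parts = pred_parts[OF x x x] pred_parts[OF y y y]
  note [measurable] = pred_lin_top[OF parts(1) parts(1) parts(1)] pred_no_min[OF parts(1) z z]
    pred_forcing[OF parts(1) z z] pred_generic[OF parts(1) z parts(2)]
    pred_generic[OF parts(1) z parts(4)] pred_eq_bits[OF parts(1) parts(3) z]
  show "Measurable.pred M (\<lambda>p. bad_witness (x p) (z p))"
    unfolding bad_witness_def by measurable
  show "Measurable.pred M (\<lambda>p. good_witness (x p) (y p) (z p))"
    unfolding good_witness_def by measurable
qed

lemma borel_class_unfolding:
  fixes x y z :: "'a::topological_space \<Rightarrow> nat \<Rightarrow> bool"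
  assumes "continuous_on UNIV x" "continuous_on UNIV y" "continuous_on UNIV z"
  shows "{p. (x p, y p, z p) \<in> class_unfolding} \<in> sets borel"
proof -
  note x = pred_bit_continuous[OF assms(1)] and y = pred_bit_continuous[OF assms(2)]
    and z = pred_bit_continuous[OF assms(3)]
  note z' = pred_parts[OF z z z]
  note [measurable] = pred_eq_bits[OF x y y] pred_witness(2)[OF x y z]
    pred_witness(1)[OF x x z'(1)] pred_witness(1)[OF x x z'(2)]
    pred_witness(1)[OF y y z'(1)] pred_witness(1)[OF y y z'(2)]
  have "Measurable.pred borel (\<lambda>p. (x p, y p, z p) \<in> class_unfolding)"
    unfolding class_unfolding_def by simp
  thus ?thesis by (simp add: pred_def)
qed

subsection \<open>The graph\<close>

definition class_edge :: "(nat \<Rightarrow> bool) \<Rightarrow> (nat \<Rightarrow> bool) \<Rightarrow> bool" where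
  "class_edge x y \<longleftrightarrow> (\<exists>b<2. good_witness x y (diff_code b (upart x) (upart y))) \<or>
     wpart y = (\<lambda>_. False) \<and> bad_witness x (upart y) \<or> wpart x = (\<lambda>_. False) \<and> bad_witness y (upart x)"

definition class_graph :: "(nat \<Rightarrow> bool) rel" where
  "class_graph = {(x, y). x \<noteq> y \<and> class_edge x y}"

lemma class_edge_commute: "class_edge x y \<longleftrightarrow> class_edge y x"
  unfolding class_edge_def using good_witness_commute diff_code_commute by metis

lemma borel_graph_class_graph: "borel_graph cantor_space class_graph"
proof -
  have "continuous_on UNIV (fst :: (nat \<Rightarrow> bool) \<times> (nat \<Rightarrow> bool) \<Rightarrow> _)"
    "continuous_on UNIV (snd :: (nat \<Rightarrow> bool) \<times> (nat \<Rightarrow> bool) \<Rightarrow> _)"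
    by (intro continuous_intros)+
  note x = this(1)[THEN pred_bit_continuous] and y = this(2)[THEN pred_bit_continuous]
  note x' = pred_parts[OF x x x] and y' = pred_parts[OF y y y]
  have F: "Measurable.pred borel (\<lambda>p :: (nat \<Rightarrow> bool) \<times> (nat \<Rightarrow> bool). (\<lambda>_. False) i)" for i :: nat
    by simp
  note [measurable] = pred_eq_bits[OF x y y] pred_eq_bits[OF x'(1) F F] pred_eq_bits[OF y'(1) F F]
    pred_witness(2)[OF x y pred_diff_code[OF x'(2) y'(2) y]]
    pred_witness(1)[OF x x y'(2)] pred_witness(1)[OF y y x'(2)]
  have "Measurable.pred borel (\<lambda>p. fst p \<noteq> snd p \<and> class_edge (fst p) (snd p))"
    unfolding class_edge_def by measurable
  hence "class_graph \<in> sets borel"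
    by (simp add: pred_def class_graph_def case_prod_unfold)
  moreover have "sym class_graph" "irrefl class_graph"
    using class_edge_commute by (auto simp: sym_def irrefl_def class_graph_def)
  ultimately show ?thesis
    by (simp add: borel_graph_def prod_topology_euclidean sets_borel_of_euclidean)
qed

lemma class_edge_class_rel: "class_edge x y \<Longrightarrow> (x, y) \<in> class_rel"
  unfolding class_edge_def
  using good_witness_class_rel bad_witness_class_rel bad_if_blank by blast

lemma class_edge_rtrancl: "class_edge x y \<Longrightarrow> (x, y) \<in> class_graph\<^sup>*"
  by (cases "x = y") (auto simp: class_graph_def)

text \<open>The path has three edges. The even bits of its inner points are spent on coding
  \<open>H\<close> against \<open>x\<close> and \<open>y\<close>, so the middle edge uses the odd
  bits. \<open>ex_generic_pair\<close> first makes the odd bits agree; changing one point on odd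
  positions then codes \<open>H\<close> between them and disturbs no even bit.\<close>

lemma good_connected:
  assumes "good_witness x y H"
  shows "(x, y) \<in> class_graph\<^sup>*"
proof -
  define w D where "w = wpart x" and "D = decides w H"
  have w: "wpart y = w" "forcing w H" and x: "generic D (upart x)" and y: "generic D (upart y)"
    using assms by (auto simp: good_witness_def w_def D_def)
  let ?A = "{i. i mod 2 = (0::nat)}"
  obtain v where v: "generic D v" "diff_code 0 (upart x) v = H"
    using ex_generic_diff_code[OF x, of 0 H] by auto
  obtain v' where v': "generic D v'" "diff_code 0 (upart y) v' = H"
    using ex_generic_diff_code[OF y, of 0 H] by auto
  obtain u1 q where u1: "generic D u1" "generic D q" "\<And>i. i \<in> ?A \<Longrightarrow> u1 i = v i \<and> q i = v' i"
      "\<And>i. i \<notin> ?A \<Longrightarrow> u1 i = q i"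
    using ex_generic_pair[OF generic_on_mono[OF v(1), of ?A] generic_on_mono[OF v'(1), of ?A]] by auto
  obtain u2 where u2: "generic D u2" "diff_code 1 q u2 = H" "\<And>i. i mod 2 \<noteq> 1 \<Longrightarrow> u2 i = q i"
    using ex_generic_diff_code[OF u1(2), of 1 H] by auto
  have "diff_code 0 (upart x) u1 = diff_code 0 (upart x) v"
    using u1(3) by (simp add: diff_code_def)
  hence "class_edge x (w \<oplus>\<^sub>T u1)"
    unfolding class_edge_def using v x u1 w
    by (intro disjI1 exI[of _ 0]) (simp add: good_witness_def w_def D_def)
  moreover have "diff_code 1 u1 u2 = diff_code 1 q u2"
    using u1(4) by (simp add: diff_code_def)
  hence "class_edge (w \<oplus>\<^sub>T u1) (w \<oplus>\<^sub>T u2)"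
    unfolding class_edge_def using u1 u2 w
    by (intro disjI1 exI[of _ 1]) (simp add: good_witness_def D_def)
  moreover have "diff_code 0 u2 (upart y) = diff_code 0 v' (upart y)"
    using u1(3) u2(3) by (simp add: diff_code_def)
  hence "class_edge (w \<oplus>\<^sub>T u2) y"
    unfolding class_edge_def using u2 v' y w diff_code_commute[of 0 v']
    by (intro disjI1 exI[of _ 0]) (simp add: good_witness_def D_def)
  ultimately show ?thesis by (meson class_edge_rtrancl rtrancl_trans)
qed

lemma borel_graphable_class_rel: "borel_graphable cantor_space class_rel"
proof -
  have "(x, y) \<in> class_rel" if "(x, y) \<in> class_graph\<^sup>*" for x y
    using that
  proof induction
    case base
    show ?case using equiv_class_rel by (auto simp: equiv_def refl_on_def)
  next
    case (step y z)
    thus ?case using class_edge_class_rel[of y z] equiv_class_rel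
      by (auto simp: class_graph_def equiv_def dest: transD)
  qed
  moreover have "(x, y) \<in> class_graph\<^sup>*" if "(x, y) \<in> class_rel" for x y
  proof (cases "bad x")
    case True
    then obtain z z' where z: "bad_witness x z" "bad_witness y z'"
      using \<open>(x, y) \<in> class_rel\<close> by (auto simp: class_rel_def bad_def)
    \<comment> \<open>Any two blank points are adjacent or equal, because every real witnesses their
      badness.\<close>
    let ?h = "\<lambda>z. (\<lambda>_. False) \<oplus>\<^sub>T z"
    have "class_edge x (?h z)" "class_edge (?h z) (?h z')" "class_edge (?h z') y"
      using z bad_if_blank by (simp_all add: class_edge_def)
    thus ?thesis by (meson class_edge_rtrancl rtrancl_trans)
  next
    case False
    then obtain H where "forcing (wpart x) H" using not_bad_ex by blast
    hence "good_witness x y H"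
      using False \<open>(x, y) \<in> class_rel\<close> not_bad_iff[of x H] not_bad_iff[of y H]
      by (auto simp: good_witness_def class_rel_def)
    thus ?thesis by (rule good_connected)
  qed
  ultimately have "class_rel = {(x, y). (x, y) \<in> class_graph\<^sup>*}" by auto
  thus ?thesis
    using borel_graph_class_graph by (auto simp: borel_graphable_def)
qed

subsection \<open>Coding properties\<close>

lemma analytic_equiv_class_rel: "analytic_equiv cantor_space class_rel"
proof -
  let ?B = "{p. (fst (fst p), snd (fst p), snd p) \<in> class_unfolding}"
  have "?B \<in> sets borel"
    by (intro borel_class_unfolding continuous_intros)
  moreover have "class_rel = fst ` ?B"
    by (auto simp: class_rel_iff image_iff)
  ultimately have "analytic_in (prod_topology cantor_space cantor_space) class_rel"
    unfolding analytic_in_def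
    by (intro exI[of _ cantor_space] exI[of _ ?B])
      (simp add: Polish_space_cantor prod_topology_euclidean sets_borel_of_euclidean)
  thus ?thesis using equiv_class_rel by (simp add: analytic_equiv_def)
qed

lemma unfolding_class_rel: "unfolding_of cantor_space class_rel class_unfolding"
proof -
  have "{p. (fst p, fst (snd p), snd (snd p)) \<in> class_unfolding} \<in> sets borel"
    by (intro borel_class_unfolding continuous_intros)
  hence "class_unfolding \<in> sets borel" by simp
  thus ?thesis
    unfolding unfolding_of_def class_rel_iff prod_topology_euclidean sets_borel_of_euclidean
    using good_witness_commute by (auto simp: class_unfolding_def)
qed

lemma good_join:
  assumes "\<not> bad x" "forcing (wpart x) H" "generic (decides (wpart x) H) u"
  shows "good_witness x (wpart x \<oplus>\<^sub>T u) H" "(wpart x \<oplus>\<^sub>T u, x) \<in> class_rel"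
proof -
  show "good_witness x (wpart x \<oplus>\<^sub>T u) H"
    using assms not_bad_iff by (simp add: good_witness_def)
  thus "(wpart x \<oplus>\<^sub>T u, x) \<in> class_rel"
    using good_witness_class_rel good_witness_commute by blast
qed

lemma blank_class_rel: "bad x \<Longrightarrow> ((\<lambda>_. False) \<oplus>\<^sub>T u, x) \<in> class_rel"
  using bad_if_blank[of "(\<lambda>_. False) \<oplus>\<^sub>T u"] by (auto simp: class_rel_def bad_def)

lemma borel_pair_coding_class_rel: "borel_pair_coding cantor_space class_rel"
proof -
  \<comment> \<open>Blankness of the second argument tells the cases apart: points equivalent to a
    good \<open>x\<close> share its linear order, so they are not blank.\<close>
  define f where "f = (\<lambda>p. if wpart (snd p) = (\<lambda>_. False) then upart (snd p)
    else diff_code 0 (upart (fst p)) (upart (snd p)))"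
  have "continuous_on UNIV (fst :: (nat \<Rightarrow> bool) \<times> (nat \<Rightarrow> bool) \<Rightarrow> _)"
    "continuous_on UNIV (snd :: (nat \<Rightarrow> bool) \<times> (nat \<Rightarrow> bool) \<Rightarrow> _)"
    by (intro continuous_intros)+
  note x = this(1)[THEN pred_bit_continuous] and y = this(2)[THEN pred_bit_continuous]
  note x' = pred_parts[OF x x x] and y' = pred_parts[OF y y y]
  have F: "Measurable.pred borel (\<lambda>p :: (nat \<Rightarrow> bool) \<times> (nat \<Rightarrow> bool). (\<lambda>_. False) i)" for i :: nat
    by simp
  note [measurable] = pred_eq_bits[OF y'(1) F F] pred_diff_code[OF x'(2) y'(2) y] y'(2)
  have "f \<in> borel \<rightarrow>\<^sub>M borel"
  proof (rule measurable_coordinatewise_then_product, rule borel_measurable_pred)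
    fix i
    have "(\<lambda>p. f p i) = (\<lambda>p. (wpart (snd p) = (\<lambda>_. False) \<and> upart (snd p) i) \<or>
        (wpart (snd p) \<noteq> (\<lambda>_. False) \<and> diff_code 0 (upart (fst p)) (upart (snd p)) i))"
      by (auto simp: f_def)
    thus "Measurable.pred borel (\<lambda>p. f p i)" by simp
  qed
  moreover have "\<exists>y. (y, x) \<in> class_rel \<and> a \<le>\<^sub>T f (x, y)" for x a
  proof (cases "bad x")
    case True
    have "f (x, (\<lambda>_. False) \<oplus>\<^sub>T a) = a" by (simp add: f_def)
    thus ?thesis using blank_class_rel[OF True] turing_le_refl by metis
  next
    case False
    obtain H where H: "forcing (wpart x) H" "generic (decides (wpart x) H) (upart x)"
      using not_bad_ex[OF False] by blast
    obtain u where u: "generic (decides (wpart x) H) u" "diff_code 0 (upart x) u = a"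
      using ex_generic_diff_code[OF H(2), of 0 a] by auto
    have "wpart x \<noteq> (\<lambda>_. False)"
      using not_bad_ex(1)[OF False] lin_top_not_blank by (auto simp: wo_top_def)
    hence "f (x, wpart x \<oplus>\<^sub>T u) = a" using u by (simp add: f_def)
    thus ?thesis using good_join(2)[OF False H(1) u(1)] turing_le_refl by metis
  qed
  ultimately show ?thesis
    unfolding borel_pair_coding_def prod_topology_euclidean measurable_borel_of_euclidean by blast
qed

lemma weak_borel_witness_coding_class_rel:
  "weak_borel_witness_coding cantor_space (\<lambda>x. x) class_rel"
proof (rule hyperarithmetic_decoding)
  fix c
  assume c: "\<And>y. wo_top (wpart y) \<Longrightarrow> \<exists>H. forcing (wpart y) H \<and> H \<le>\<^sub>h y \<oplus>\<^sub>T c \<and>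
      decode (wpart y) H (upart y) \<le>\<^sub>h y \<oplus>\<^sub>T c"
    "\<And>y. wpart (upart y) \<le>\<^sub>h y \<oplus>\<^sub>T c" "\<And>y. upart (upart y) \<le>\<^sub>h y \<oplus>\<^sub>T c"
  have "\<exists>y. (y, x) \<in> class_rel \<and> a \<le>\<^sub>h y \<oplus>\<^sub>T c \<and>
      (\<exists>z. (x, y, z) \<in> class_unfolding \<and> z \<le>\<^sub>h y \<oplus>\<^sub>T c)" for x a
  proof (cases "bad x")
    case True
    then obtain z where z: "bad_witness x z" by (auto simp: bad_def)
    \<comment> \<open>\<open>c(2)\<close> and \<open>c(3)\<close> retrieve \<open>a\<close> and
      \<open>z \<oplus>\<^sub>T z\<close> from the second half. One copy of \<open>z\<close>
      testifies for \<open>x\<close>, the other for the blank \<open>?y\<close>, for which any real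
      would do.\<close>
    let ?y = "(\<lambda>_. False) \<oplus>\<^sub>T (a \<oplus>\<^sub>T (z \<oplus>\<^sub>T z))"
    have "(x, ?y, z \<oplus>\<^sub>T z) \<in> class_unfolding"
      using z bad_if_blank by (simp add: class_unfolding_def)
    moreover have "a \<le>\<^sub>h ?y \<oplus>\<^sub>T c" "z \<oplus>\<^sub>T z \<le>\<^sub>h ?y \<oplus>\<^sub>T c"
      using c(2)[of ?y] c(3)[of ?y] by simp_all
    ultimately show ?thesis using blank_class_rel[OF True] by blast
  next
    case False
    obtain H where H: "forcing (wpart x) H" using not_bad_ex[OF False] by blast
    obtain u where u: "generic (decides (wpart x) H) u" "decode (wpart x) H u = a"
      using ex_generic_decode[OF dense_decides[OF H]] by blast
    let ?y = "wpart x \<oplus>\<^sub>T u"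
    obtain H' where H': "forcing (wpart x) H'" "H' \<le>\<^sub>h ?y \<oplus>\<^sub>T c" "decode (wpart x) H' u \<le>\<^sub>h ?y \<oplus>\<^sub>T c"
      using c(1)[of ?y] not_bad_ex(1)[OF False] by auto
    \<comment> \<open>By uniqueness, the relation that the oracle delivers is the one used for
      coding.\<close>
    have "H' = H" using forcing_unique[OF not_bad_ex(1)[OF False] H'(1) H] .
    moreover have "(x, ?y, H) \<in> class_unfolding"
      using good_join(1)[OF False H u(1)] by (simp add: class_unfolding_def)
    ultimately show ?thesis using good_join(2)[OF False H u(1)] H' u(2) by blast
  qed
  thus ?thesis
    unfolding weak_borel_witness_coding_def using unfolding_class_rel by blast
qed

text \<open>Difference codes reveal \<open>a\<close> by a single jump of the join, so nothing is
  decoded through \<open>H\<close> here.\<close>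

lemma weak_borel_pair_coding_class_rel: "weak_borel_pair_coding cantor_space (\<lambda>x. x) class_rel"
proof (rule hyperarithmetic_pair_decoding)
  fix c
  assume c: "\<And>x y. diff_code 0 (upart x) (upart y) \<le>\<^sub>h x \<oplus>\<^sub>T y \<oplus>\<^sub>T c"
    "\<And>x y. upart y \<le>\<^sub>h x \<oplus>\<^sub>T y \<oplus>\<^sub>T c"
  have "\<exists>y. (y, x) \<in> class_rel \<and> a \<le>\<^sub>h x \<oplus>\<^sub>T y \<oplus>\<^sub>T c" for x a
  proof (cases "bad x")
    case True
    thus ?thesis using blank_class_rel[OF True, of a] c(2)[of "(\<lambda>_. False) \<oplus>\<^sub>T a" x] by auto
  next
    case False
    obtain H where H: "forcing (wpart x) H" "generic (decides (wpart x) H) (upart x)"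
      using not_bad_ex[OF False] by blast
    obtain u where u: "generic (decides (wpart x) H) u" "diff_code 0 (upart x) u = a"
      using ex_generic_diff_code[OF H(2), of 0 a] by auto
    thus ?thesis using good_join(2)[OF False H(1) u(1)] c(1)[of x "wpart x \<oplus>\<^sub>T u"] by auto
  qed
  thus ?thesis unfolding weak_borel_pair_coding_def by blast
qed

text \<open>For generic \<open>u\<close>, the class of \<open>w \<oplus>\<^sub>T u\<close> consists
  of joins of \<open>w\<close> with generic sequences, all of them excluded by the same
  \<open>a\<close>.\<close>

lemma not_borel_coding_class_rel: "\<not> borel_coding cantor_space class_rel"
proof
  assume "borel_coding cantor_space class_rel"
  then obtain f where f: "f \<in> borel \<rightarrow>\<^sub>M borel" "\<And>x a. \<exists>y. (y, x) \<in> class_rel \<and> a \<le>\<^sub>T f y"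
    unfolding borel_coding_def measurable_borel_of_euclidean by auto
  obtain w a where w: "wo_top w"
      and a: "\<And>H u. forcing w H \<Longrightarrow> generic (decides w H) u \<Longrightarrow> \<not> a \<le>\<^sub>T f (w \<oplus>\<^sub>T u)"
    using borel_function_not_coding[OF f(1)] by blast
  obtain H where H: "forcing w H" using ex_forcing[OF w] by blast
  obtain u where u: "generic (decides w H) u" using ex_generic[OF dense_decides[OF H]] by blast
  have "\<not> bad (w \<oplus>\<^sub>T u)" using not_bad_iff[of "w \<oplus>\<^sub>T u" H] w H u by simp
  moreover obtain y where y: "(y, w \<oplus>\<^sub>T u) \<in> class_rel" "a \<le>\<^sub>T f y" using f(2) by blast
  ultimately have "\<not> bad y" "wpart y = w" by (auto simp: class_rel_def)
  hence "generic (decides w H) (upart y)" using not_bad_iff[of y H] H by simp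
  from a[OF H this] show False using y(2) join_parts[of y] \<open>wpart y = w\<close> by simp
qed

theorem theorem5p10:
  shows "\<exists>(X :: (nat \<Rightarrow> bool) topology) code E.
    Polish_space X \<and> coding_map X code \<and> analytic_equiv X E \<and>
    borel_graphable X E \<and>
    borel_pair_coding X E \<and>
    weak_borel_witness_coding X code E \<and>
    weak_borel_coding X code E \<and>
    weak_borel_pair_coding X code E \<and>
    \<not> borel_coding X E"
proof (intro exI conjI)
  show "Polish_space cantor_space" by (rule Polish_space_cantor)
  show "coding_map cantor_space (\<lambda>x. x)" by (simp add: coding_map_def)
  show "weak_borel_coding cantor_space (\<lambda>x. x) class_rel"
    using weak_borel_witness_coding_class_rel
    unfolding weak_borel_coding_def weak_borel_witness_coding_def by meson
qed (fact analytic_equiv_class_rel borel_graphable_class_rel borel_pair_coding_class_rel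
  weak_borel_witness_coding_class_rel weak_borel_pair_coding_class_rel not_borel_coding_class_rel)+

end
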